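(* Let $R$ be a commutative ring and $I$ an ideal of $R$. Let $n\ge2$, $\gamma\in\operatorname{Alt}_{2n}(R,I)$ and $v\in\operatorname{Um}_{2n}(R,I)$. Suppose that the following conditions hold. (1) The canonical map $\operatorname{SL}_{2n}(R,I)/\operatorname{E}_{2n}(R,I)\to\mathrm{SK_1}(R,I)$ is injective. (2) There exists $\alpha\in\operatorname{SL}_{2n}(R,I)$ such that $v=e_1\alpha$ and the class $[\alpha]\in\mathrm{SK_1}(R,I)$ lies in the image of the natural map $f:\mathrm{K_1Sp}(R,I)\to\mathrm{SK_1}(R,I)$. (3) For all $i\ge1$, $\operatorname{Um}_{2n+2i}(R,I)=e_1\big(\operatorname{E}_{2n+2i}(R,I)\cap\operatorname{Sp}_\tau(R,I)\big)$, where $\tau=\chi_i\perp\gamma$. Then $v\in e_1\operatorname{Sp}_\gamma(R,I)$.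
   Context: Let $\chi_1=\begin{pmatrix}0&1\\-1&0\end{pmatrix}$, $\chi_{n+1}=\chi_n\perp\chi_1$ (block diagonal sum). $\operatorname{GL}_n(R,I)=\ker(\operatorname{GL}_n(R)\to\operatorname{GL}_n(R/I))$, $\operatorname{SL}_n(R,I)$ its determinant-$1$ subgroup, $\operatorname{E}_n(R,I)$ the group generated by all $\alpha e_{ij}(a)\alpha^{-1}$, $\alpha$ in the elementary group $\operatorname{E}_n(R)$, $a\in I$, $i\neq j$. $\operatorname{Alt}_{2n}(R,I)$ is the set of alternating (skew-symmetric, zero diagonal) matrices $\varphi\in\operatorname{GL}_{2n}(R)$ with Pfaffian $1$ and $\varphi\equiv\chi_n\pmod I$; for such $\varphi$, $\operatorname{Sp}_\varphi(R,I)=\{\alpha\in\operatorname{GL}_{2n}(R,I):\alpha^T\varphi\alpha=\varphi\}$, and $\operatorname{Sp}_{2n}(R,I)=\operatorname{Sp}_{\chi_n}(R,I)$. With $\sigma(2i)=2i-1$, $\sigma(2i-1)=2i$, set $se_{ij}(\lambda)=\mathrm I+\lambda E_{ij}$ if $i=\sigma(j)$ and $se_{ij}(\lambda)=\mathrm I+\lambda E_{ij}-(-1)^{i+j}\lambda E_{\sigma(j)\sigma(i)}$ if $i\ne j,\sigma(j)$; $\operatorname{ESp}_{2n}(R)$ is generated by all $se_{ij}(\lambda)$, and $\operatorname{ESp}_{2n}(R,I)$ by all $\alpha\,se_{ij}(x)\alpha^{-1}$, $\alpha\in\operatorname{ESp}_{2n}(R)$, $x\in I$. Stabilizing by $\alpha\mapsto1\perp\alpha$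 (resp. $\mathrm I_2\perp\alpha$), $\mathrm{SK_1}(R,I)=\operatorname{SL}(R,I)/\operatorname{E}(R,I)$ and $\mathrm{K_1Sp}(R,I)=\operatorname{Sp}(R,I)/\operatorname{ESp}(R,I)$ (direct limits); $f$ is induced by the inclusion $\operatorname{Sp}_{2n}(R,I)\subset\operatorname{SL}_{2n}(R,I)$. $\operatorname{Um}_n(R,I)$ is the set of unimodular rows of length $n$ over $R$ congruent to $e_1=(1,0,\dots,0)$ modulo $I$; $e_1G=\{e_1\alpha:\alpha\in G\}$. *)

theory Defs
  imports
    "Jordan_Normal_Form.Matrix"
    "Jordan_Normal_Form.Determinant"
    "Jordan_Normal_Form.VS_Connect"
    "HOL-Algebra.Generated_Groups"
    "HOL-Algebra.Coset"
    "HOL-Algebra.Ideal"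
begin

text \<open>
  The ring \<open>R\<close> is the type \<open>'a :: comm_ring_1\<close>; \<open>class_ring\<close> is that type viewed as a ring record,
  and ideals are ideals of this record. Matrices and rows are indexed from 0, so the row \<open>e\<^sub>1\<close>
  is \<open>unit_vec n 0\<close>.
\<close>

section \<open>Linear groups and congruence subgroups\<close>

definition block_sum :: "'a::zero mat \<Rightarrow> 'a mat \<Rightarrow> 'a mat" (infixl \<open>\<perp>\<close> 65) where
  "A \<perp> B = four_block_mat A (0\<^sub>m (dim_row A) (dim_col B)) (0\<^sub>m (dim_row B) (dim_col A)) B"

definition mat_cong :: "'a::comm_ring_1 set \<Rightarrow> 'a mat \<Rightarrow> 'a mat \<Rightarrow> bool" where
  "mat_cong I A B \<longleftrightarrow> dim_row A = dim_row B \<and> dim_col A = dim_col B \<and>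
     (\<forall>i < dim_row A. \<forall>j < dim_col A. A $$ (i, j) - B $$ (i, j) \<in> I)"

definition GL :: "nat \<Rightarrow> 'a::comm_ring_1 mat monoid" where
  "GL n = units_of (ring_mat TYPE('a) n ())"

text \<open>The kernel of reduction modulo \<open>I\<close>: invertible matrices congruent to the identity.\<close>

definition GL_rel :: "nat \<Rightarrow> 'a::comm_ring_1 set \<Rightarrow> 'a mat set" where
  "GL_rel n I = {\<alpha> \<in> carrier (GL n). mat_cong I \<alpha> (1\<^sub>m n)}"

definition SL_rel :: "nat \<Rightarrow> 'a::comm_ring_1 set \<Rightarrow> 'a mat set" where
  "SL_rel n I = {\<alpha> \<in> GL_rel n I. det \<alpha> = 1}"

definition SL_group :: "nat \<Rightarrow> 'a::comm_ring_1 set \<Rightarrow> 'a mat monoid" where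
  "SL_group n I = (GL n)\<lparr>carrier := SL_rel n I\<rparr>"

section \<open>Elementary groups\<close>

definition mat_unit :: "nat \<Rightarrow> nat \<Rightarrow> nat \<Rightarrow> 'a::comm_ring_1 mat" where
  "mat_unit n i j = mat n n (\<lambda>(k, l). if k = i \<and> l = j then 1 else 0)"

definition elem_mat :: "nat \<Rightarrow> nat \<Rightarrow> nat \<Rightarrow> 'a::comm_ring_1 \<Rightarrow> 'a mat" where
  "elem_mat n i j a = 1\<^sub>m n + a \<cdot>\<^sub>m mat_unit n i j"

definition E_abs :: "nat \<Rightarrow> 'a::comm_ring_1 mat set" where
  "E_abs n = generate (GL n) {elem_mat n i j a | i j a. i < n \<and> j < n \<and> i \<noteq> j}"

definition E_rel :: "nat \<Rightarrow> 'a::comm_ring_1 set \<Rightarrow> 'a mat set" where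
  "E_rel n I = generate (GL n)
     {\<alpha> * elem_mat n i j a * inv\<^bsub>GL n\<^esub> \<alpha> | \<alpha> i j a.
        \<alpha> \<in> E_abs n \<and> i < n \<and> j < n \<and> i \<noteq> j \<and> a \<in> I}"

section \<open>Alternating matrices and symplectic groups\<close>

definition chi1 :: "'a::comm_ring_1 mat" where
  "chi1 = mat_of_rows_list 2 [[0, 1], [-1, 0]]"

text \<open>Starting from the empty matrix, so that \<open>chi 1 = chi1\<close>.\<close>

primrec chi :: "nat \<Rightarrow> 'a::comm_ring_1 mat" where
  "chi 0 = 0\<^sub>m 0 0"
| "chi (Suc n) = chi n \<perp> chi1"

definition alternating_mat :: "'a::comm_ring_1 mat \<Rightarrow> bool" where
  "alternating_mat A \<longleftrightarrow> square_mat A \<and> transpose_mat A = - A \<and> (\<forall>i < dim_row A. A $$ (i, i) = 0)"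

text \<open>
  The Pfaffian is the signed sum over the perfect matchings of \<open>{0, \<dots>, 2k - 1}\<close>. The matching
  \<open>{p 0, p 1}, {p 2, p 3}, \<dots>\<close> is represented by the unique such permutation whose pairs are
  increasing and listed by increasing first entry; this normalisation gives \<open>chi k\<close> Pfaffian 1.
\<close>

definition pfaffian :: "'a::comm_ring_1 mat \<Rightarrow> 'a" where
  "pfaffian A = (let k = dim_row A div 2 in
     \<Sum>p \<in> {p. p permutes {0..<2 * k} \<and> (\<forall>i < k. p (2 * i) < p (2 * i + 1)) \<and>
               (\<forall>i. i + 1 < k \<longrightarrow> p (2 * i) < p (2 * (i + 1)))}.
       signof p * (\<Prod>i = 0..<k. A $$ (p (2 * i), p (2 * i + 1))))"

definition Alt :: "nat \<Rightarrow> 'a::comm_ring_1 set \<Rightarrow> 'a mat set" where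
  "Alt n I = {\<phi> \<in> carrier (GL (2 * n)). alternating_mat \<phi> \<and> pfaffian \<phi> = 1 \<and> mat_cong I \<phi> (chi n)}"

definition Sp_rel :: "'a::comm_ring_1 mat \<Rightarrow> 'a set \<Rightarrow> 'a mat set" where
  "Sp_rel \<phi> I = {\<alpha> \<in> GL_rel (dim_row \<phi>) I. transpose_mat \<alpha> * \<phi> * \<alpha> = \<phi>}"

definition Sp_group :: "nat \<Rightarrow> 'a::comm_ring_1 set \<Rightarrow> 'a mat monoid" where
  "Sp_group n I = (GL (2 * n))\<lparr>carrier := Sp_rel (chi n) I\<rparr>"

text \<open>The swap of 1 with 2, 3 with 4, and so on, for indices shifted down by one.\<close>

definition sigma :: "nat \<Rightarrow> nat" where
  "sigma i = (if even i then i + 1 else i - 1)"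

definition se_mat :: "nat \<Rightarrow> nat \<Rightarrow> nat \<Rightarrow> 'a::comm_ring_1 \<Rightarrow> 'a mat" where
  "se_mat n i j a =
     (if i = sigma j then 1\<^sub>m (2 * n) + a \<cdot>\<^sub>m mat_unit (2 * n) i j
      else 1\<^sub>m (2 * n) + a \<cdot>\<^sub>m mat_unit (2 * n) i j
             - ((-1) ^ (i + j) * a) \<cdot>\<^sub>m mat_unit (2 * n) (sigma j) (sigma i))"

definition ESp_abs :: "nat \<Rightarrow> 'a::comm_ring_1 mat set" where
  "ESp_abs n = generate (GL (2 * n)) {se_mat n i j a | i j a. i < 2 * n \<and> j < 2 * n \<and> i \<noteq> j}"

definition ESp_rel :: "nat \<Rightarrow> 'a::comm_ring_1 set \<Rightarrow> 'a mat set" where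
  "ESp_rel n I = generate (GL (2 * n))
     {\<alpha> * se_mat n i j a * inv\<^bsub>GL (2 * n)\<^esub> \<alpha> | \<alpha> i j a.
        \<alpha> \<in> ESp_abs n \<and> i < 2 * n \<and> j < 2 * n \<and> i \<noteq> j \<and> a \<in> I}"

section \<open>Direct limits\<close>

text \<open>
  The direct limit of a sequence of groups \<open>G 0 \<rightarrow> G 1 \<rightarrow> \<dots>\<close> all of whose transition maps are
  restrictions of one function \<open>s\<close>. Elements are classes of pairs \<open>(n, x)\<close> with \<open>x \<in> G n\<close>,
  two pairs being identified if they become equal at some later stage.
\<close>

definition dl_rel :: "(nat \<Rightarrow> 'b monoid) \<Rightarrow> ('b \<Rightarrow> 'b) \<Rightarrow> ((nat \<times> 'b) \<times> (nat \<times> 'b)) set" where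
  "dl_rel G s = {((m, x), (n, y)). x \<in> carrier (G m) \<and> y \<in> carrier (G n) \<and>
     (\<exists>p q. m + p = n + q \<and> (s ^^ p) x = (s ^^ q) y)}"

definition dl_in :: "(nat \<Rightarrow> 'b monoid) \<Rightarrow> ('b \<Rightarrow> 'b) \<Rightarrow> nat \<Rightarrow> 'b \<Rightarrow> (nat \<times> 'b) set" where
  "dl_in G s n x = dl_rel G s `` {(n, x)}"

text \<open>
  Classes at stages \<open>m\<close> and \<open>n\<close> are multiplied at the common stage \<open>m + n\<close>. The union is over all
  representatives; its members coincide, so it is a single class.
\<close>

definition direct_limit :: "(nat \<Rightarrow> 'b monoid) \<Rightarrow> ('b \<Rightarrow> 'b) \<Rightarrow> (nat \<times> 'b) set monoid" where
  "direct_limit G s =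
     \<lparr>carrier = (SIGMA n:UNIV. carrier (G n)) // dl_rel G s,
      mult = (\<lambda>X Y. \<Union>(m, x)\<in>X. \<Union>(n, y)\<in>Y.
                dl_in G s (m + n) ((s ^^ n) x \<otimes>\<^bsub>G (m + n)\<^esub> (s ^^ m) y)),
      one = dl_in G s 0 \<one>\<^bsub>G 0\<^esub>\<rparr>"

text \<open>
  The map of quotients \<open>G/N \<rightarrow> H/M\<close> induced by \<open>h : G \<rightarrow> H\<close> with \<open>h N \<subseteq> M\<close>: it sends the coset
  \<open>N x\<close> to \<open>M h(N x) = M h(x)\<close>.
\<close>

definition quot_map :: "('c, 'd) monoid_scheme \<Rightarrow> 'c set \<Rightarrow> ('b \<Rightarrow> 'c) \<Rightarrow> 'b set \<Rightarrow> 'c set" where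
  "quot_map H M h C = M <#>\<^bsub>H\<^esub> (h ` C)"

section \<open>The stable groups\<close>

definition SL_lim_in :: "'a::comm_ring_1 set \<Rightarrow> nat \<Rightarrow> 'a mat \<Rightarrow> (nat \<times> 'a mat) set" where
  "SL_lim_in I = dl_in (\<lambda>n. SL_group n I) (\<lambda>\<alpha>. 1\<^sub>m 1 \<perp> \<alpha>)"

definition SL_lim :: "'a::comm_ring_1 set \<Rightarrow> (nat \<times> 'a mat) set monoid" where
  "SL_lim I = direct_limit (\<lambda>n. SL_group n I) (\<lambda>\<alpha>. 1\<^sub>m 1 \<perp> \<alpha>)"

definition E_lim :: "'a::comm_ring_1 set \<Rightarrow> (nat \<times> 'a mat) set set" where
  "E_lim I = (\<Union>n. SL_lim_in I n ` E_rel n I)"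

definition SK1 :: "'a::comm_ring_1 set \<Rightarrow> (nat \<times> 'a mat) set set monoid" where
  "SK1 I = SL_lim I Mod E_lim I"

definition SK1_class :: "'a::comm_ring_1 set \<Rightarrow> nat \<Rightarrow> 'a mat \<Rightarrow> (nat \<times> 'a mat) set set" where
  "SK1_class I n \<alpha> = E_lim I #>\<^bsub>SL_lim I\<^esub> SL_lim_in I n \<alpha>"

definition to_SK1 :: "'a::comm_ring_1 set \<Rightarrow> nat \<Rightarrow> 'a mat set \<Rightarrow> (nat \<times> 'a mat) set set" where
  "to_SK1 I n = quot_map (SL_lim I) (E_lim I) (SL_lim_in I n)"

definition Sp_lim_in :: "'a::comm_ring_1 set \<Rightarrow> nat \<Rightarrow> 'a mat \<Rightarrow> (nat \<times> 'a mat) set" where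
  "Sp_lim_in I = dl_in (\<lambda>n. Sp_group n I) (\<lambda>\<alpha>. 1\<^sub>m 2 \<perp> \<alpha>)"

definition Sp_lim :: "'a::comm_ring_1 set \<Rightarrow> (nat \<times> 'a mat) set monoid" where
  "Sp_lim I = direct_limit (\<lambda>n. Sp_group n I) (\<lambda>\<alpha>. 1\<^sub>m 2 \<perp> \<alpha>)"

definition ESp_lim :: "'a::comm_ring_1 set \<Rightarrow> (nat \<times> 'a mat) set set" where
  "ESp_lim I = (\<Union>n. Sp_lim_in I n ` ESp_rel n I)"

definition K1Sp :: "'a::comm_ring_1 set \<Rightarrow> (nat \<times> 'a mat) set set monoid" where
  "K1Sp I = Sp_lim I Mod ESp_lim I"

text \<open>
  The map of limits induced by the inclusions of the symplectic into the special linear groups.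
  Stage \<open>n\<close> of the symplectic sequence consists of matrices of size \<open>2n\<close>, hence the doubled index.
\<close>

definition Sp_to_SL :: "'a::comm_ring_1 set \<Rightarrow> (nat \<times> 'a mat) set \<Rightarrow> (nat \<times> 'a mat) set" where
  "Sp_to_SL I X = (\<Union>(n, \<alpha>)\<in>X. SL_lim_in I (2 * n) \<alpha>)"

definition K1Sp_to_SK1 :: "'a::comm_ring_1 set \<Rightarrow> (nat \<times> 'a mat) set set \<Rightarrow> (nat \<times> 'a mat) set set" where
  "K1Sp_to_SK1 I = quot_map (SL_lim I) (E_lim I) (Sp_to_SL I)"

section \<open>Unimodular rows\<close>

definition Um :: "nat \<Rightarrow> 'a::comm_ring_1 set \<Rightarrow> 'a vec set" where
  "Um n I = {v \<in> carrier_vec n. (\<exists>w \<in> carrier_vec n. v \<bullet> w = 1) \<and>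
     (\<forall>i < n. v $ i - unit_vec n 0 $ i \<in> I)}"

definition row_mult :: "'a::comm_ring_1 vec \<Rightarrow> 'a mat \<Rightarrow> 'a vec" where
  "row_mult v A = transpose_mat A *\<^sub>v v"

definition e1_orbit :: "nat \<Rightarrow> 'a::comm_ring_1 mat set \<Rightarrow> 'a vec set" where
  "e1_orbit n S = (\<lambda>\<alpha>. row_mult (unit_vec n 0) \<alpha>) ` S"

end

theory Submission
  imports Defs
begin

text \<open>
  If \<open>\<beta>\<close> is symplectic for \<open>chi m\<close> and stably congruent to \<open>\<alpha>\<close> modulo \<open>E(R, I)\<close>, then \<open>\<beta> \<perp> 1\<close> is
  symplectic for \<open>chi i \<perp> \<gamma>\<close> and, by the relative Whitehead lemma, stably congruent to \<open>\<alpha>\<close> as well.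
  The orbit hypothesis moves its first row to \<open>e\<^sub>1\<close> by an elementary symplectic matrix, after which a
  hyperbolic plane splits off up to elementary factors; iterating gives \<open>D\<close> in \<open>Sp_rel \<gamma> I\<close> stably
  congruent to \<open>\<alpha>\<close>. Injectivity yields \<open>\<alpha> = \<epsilon> D\<close> with \<open>\<epsilon>\<close> in \<open>E_rel (2 * n) I\<close>, and
  \<open>e\<^sub>1 \<epsilon>\<close> lies in \<open>e\<^sub>1 Sp_rel \<gamma> I\<close>, because linear and symplectic orbits of \<open>e\<^sub>1\<close> agree.

  The matrix \<open>\<beta>\<close> is read off from the direct limit without knowing that symplectic matrices
  have determinant 1: a limit class taken at a matrix outside \<open>SL\<close> is empty.
\<close>

section \<open>Matrix groups\<close>

text \<open>Stabilization puts the identity in front, so a stabilized \<beta> occupies the lower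
  right corner, which is where \<gamma> sits in \<open>chi i \<perp> \<gamma>\<close>; there it need
  not preserve the form. In the upper left corner it meets only hyperbolic planes and is an isometry
  whatever \<gamma> is. Moving between the corners costs a factor of the shape
  \<open>gl_inv N \<beta> \<perp> \<beta>\<close>, and this is the factor that the Whitehead lemma
  shows to be elementary relative to \<open>I\<close>. All elementary factors are collected to the
  left of the symplectic ones, so that they multiply together and the last equation has the shape
  \<alpha> = \<epsilon> D. The orbits of the first unit row cannot be compared generator by
  generator: a generator conjugated by an arbitrary elementary matrix has no visible symplectic
  counterpart. It is instead broken into matrices that fix the first unit vector as a row or as a
  column. Each of these differs from an isometry by a matrix fixing both, and passing to rows whose
  images under all such matrices stay in the orbit absorbs the difference.\<close>

lemma square_mult_closed: "A \<in> carrier_mat n n \<Longrightarrow> B \<in> carrier_mat n n \<Longrightarrow> A * B \<in> carrier_mat n n"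
  by simp

lemma square_assoc:
  "A \<in> carrier_mat n n \<Longrightarrow> B \<in> carrier_mat n n \<Longrightarrow> C \<in> carrier_mat n n
    \<Longrightarrow> (A * B) * C = A * (B * (C :: 'a::semiring_1 mat))"
  by (rule assoc_mult_mat)

lemmas square_simps = square_assoc square_mult_closed

lemma GL_simps [simp]:
  "mult (GL n :: 'a::comm_ring_1 mat monoid) = (*)"
  "one (GL n :: 'a::comm_ring_1 mat monoid) = 1\<^sub>m n"
  by (simp_all add: GL_def units_of_def ring_mat_def)

lemma carrier_GL:
  "A \<in> carrier (GL n :: 'a::comm_ring_1 mat monoid) \<longleftrightarrow>
     A \<in> carrier_mat n n \<and> (\<exists>B \<in> carrier_mat n n. A * B = 1\<^sub>m n \<and> B * A = 1\<^sub>m n)"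
  by (auto simp: GL_def units_of_def Units_def ring_mat_def)

lemma group_GL: "group (GL n :: 'a::comm_ring_1 mat monoid)"
proof -
  interpret semiring "ring_mat TYPE('a) n ()" by (rule semiring_mat)
  show ?thesis unfolding GL_def by (rule units_group)
qed

lemma GL_carrier_mat: "A \<in> carrier (GL n) \<Longrightarrow> A \<in> carrier_mat n n"
  by (simp add: carrier_GL)

lemma GL_I: "A \<in> carrier_mat n n \<Longrightarrow> B \<in> carrier_mat n n \<Longrightarrow> A * B = 1\<^sub>m n \<Longrightarrow> B * A = 1\<^sub>m n
    \<Longrightarrow> A \<in> carrier (GL n)"
  by (auto simp: carrier_GL)

lemma GL_mult: "A \<in> carrier (GL n) \<Longrightarrow> B \<in> carrier (GL n) \<Longrightarrow> A * B \<in> carrier (GL n)"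
  using group.subgroup_self[OF group_GL, of n] subgroup.m_closed by fastforce

lemma GL_one: "1\<^sub>m n \<in> carrier (GL n)"
  by (rule GL_I[of _ _ "1\<^sub>m n"]) auto

abbreviation gl_inv :: "nat \<Rightarrow> 'a::comm_ring_1 mat \<Rightarrow> 'a mat" where
  "gl_inv n A \<equiv> inv\<^bsub>GL n\<^esub> A"

lemma GL_inv: "A \<in> carrier (GL n) \<Longrightarrow> gl_inv n A \<in> carrier (GL n)"
  using group.inv_closed[OF group_GL] by blast

lemma GL_inv_carrier_mat: "A \<in> carrier (GL n) \<Longrightarrow> gl_inv n A \<in> carrier_mat n n"
  using GL_inv GL_carrier_mat by blast

lemma GL_l_inv: "A \<in> carrier (GL n) \<Longrightarrow> gl_inv n A * A = 1\<^sub>m n"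
  using group.l_inv[OF group_GL, of A n] by simp

lemma GL_r_inv: "A \<in> carrier (GL n) \<Longrightarrow> A * gl_inv n A = 1\<^sub>m n"
  using group.r_inv[OF group_GL, of A n] by simp

lemma GL_inv_eq:
  assumes "A \<in> carrier_mat n n" "B \<in> carrier_mat n n" "A * B = 1\<^sub>m n" "B * A = 1\<^sub>m n"
  shows "gl_inv n A = B"
proof -
  have "A \<in> carrier (GL n)" "B \<in> carrier (GL n)" using assms by (auto intro: GL_I)
  then show ?thesis using group.inv_equality[OF group_GL, where x = A and y = B] assms by simp
qed

lemma GL_inv_mult:
  "A \<in> carrier (GL n) \<Longrightarrow> B \<in> carrier (GL n) \<Longrightarrow> gl_inv n (A * B) = gl_inv n B * gl_inv n A"
  using group.inv_mult_group[OF group_GL, of A n B] by simp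

lemma GL_inv_inv: "A \<in> carrier (GL n) \<Longrightarrow> gl_inv n (gl_inv n A) = A"
  using group.inv_inv[OF group_GL, of A n] by simp

lemma mult_cancel_mid:
  assumes "A \<in> carrier_mat n n" "B \<in> carrier_mat n n" "C \<in> carrier_mat n n" "D \<in> carrier_mat n n"
    "B * C = 1\<^sub>m n"
  shows "(A * B) * (C * D) = A * (D :: 'a::comm_ring_1 mat)"
proof -
  have "(A * B) * (C * D) = A * ((B * C) * D)"
    using assms(1-4) by (smt (verit) assoc_mult_mat mult_carrier_mat)
  then show ?thesis using assms by simp
qed

text \<open>Cramer's rule: since \<open>det B * det A = 1\<close>, the adjugate of \<open>A\<close>
  scaled by \<open>det B\<close> is a right inverse of \<open>A\<close>, and it must agree with the
  left inverse \<open>B\<close>.\<close>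

lemma mat_left_inverse_comm:
  fixes A B :: "'a::comm_ring_1 mat"
  assumes A: "A \<in> carrier_mat n n" and B: "B \<in> carrier_mat n n" and BA: "B * A = 1\<^sub>m n"
  shows "A * B = 1\<^sub>m n"
proof -
  define X where "X = det B \<cdot>\<^sub>m adj_mat A"
  have X: "X \<in> carrier_mat n n" using adj_mat(1)[OF A] by (simp add: X_def)
  have d: "det B * det A = 1" using det_mult[OF B A] BA by simp
  have "A * X = det B \<cdot>\<^sub>m (A * adj_mat A)"
    unfolding X_def using A adj_mat(1)[OF A] by (rule mult_smult_distrib)
  also have "\<dots> = 1\<^sub>m n" unfolding adj_mat(2)[OF A] using d by (auto simp: mult.assoc[symmetric])
  finally have AX: "A * X = 1\<^sub>m n" .
  have "B = B * (A * X)" using AX B by simp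
  also have "\<dots> = (B * A) * X" using A B X by simp
  finally have "B = X" using BA X by simp
  then show ?thesis using AX by simp
qed

section \<open>Ideals and congruences\<close>

lemma ideal_closed:
  assumes "ideal I (class_ring :: 'a::comm_ring_1 ring)"
  shows "0 \<in> I" "\<And>x y. x \<in> I \<Longrightarrow> y \<in> I \<Longrightarrow> x + y \<in> I"
    "\<And>a x. x \<in> I \<Longrightarrow> a * x \<in> I" "\<And>a x. x \<in> I \<Longrightarrow> x * a \<in> I"
    "\<And>x. x \<in> I \<Longrightarrow> - x \<in> I" "\<And>x y. x \<in> I \<Longrightarrow> y \<in> I \<Longrightarrow> x - y \<in> I"
proof -
  interpret ideal I "class_ring :: 'a ring" by fact
  show z: "0 \<in> I" using zero_closed by simp
  show a: "\<And>x y. x \<in> I \<Longrightarrow> y \<in> I \<Longrightarrow> x + y \<in> I" using a_closed by simp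
  show m: "\<And>a x. x \<in> I \<Longrightarrow> a * x \<in> I" using I_l_closed by simp
  show "\<And>a x. x \<in> I \<Longrightarrow> x * a \<in> I" using m by (metis mult.commute)
  have u: "- x \<in> I" if "x \<in> I" for x using m[OF that, of "-1"] by simp
  then show "\<And>x. x \<in> I \<Longrightarrow> - x \<in> I" .
  show "\<And>x y. x \<in> I \<Longrightarrow> y \<in> I \<Longrightarrow> x - y \<in> I" using a u by (metis add_uminus_conv_diff)
qed

locale ring_ideal =
  fixes I :: "'a::comm_ring_1 set"
  assumes ideal: "ideal I (class_ring :: 'a ring)"
begin

lemmas I_zero = ideal_closed(1)[OF ideal]
  and I_add = ideal_closed(2)[OF ideal]
  and I_lmult = ideal_closed(3)[OF ideal]
  and I_rmult = ideal_closed(4)[OF ideal]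
  and I_uminus = ideal_closed(5)[OF ideal]
  and I_diff = ideal_closed(6)[OF ideal]

lemma I_sum: "(\<And>x. x \<in> S \<Longrightarrow> f x \<in> I) \<Longrightarrow> sum f S \<in> I"
  by (induct S rule: infinite_finite_induct) (auto intro: I_zero I_add)

lemma mat_cong_refl: "mat_cong I A A"
  by (simp add: mat_cong_def I_zero)

lemma mat_cong_sym: "mat_cong I A B \<Longrightarrow> mat_cong I B A"
  unfolding mat_cong_def by (metis I_uminus minus_diff_eq)

lemma mat_cong_mult:
  assumes "A \<in> carrier_mat n m" "A' \<in> carrier_mat n m" "B \<in> carrier_mat m k" "B' \<in> carrier_mat m k"
    and "mat_cong I A A'" "mat_cong I B B'"
  shows "mat_cong I (A * B) (A' * B')"
proof -
  have "(A * B) $$ (i, j) - (A' * B') $$ (i, j) \<in> I" if ij: "i < n" "j < k" for i j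
  proof -
    have "(A * B) $$ (i, j) - (A' * B') $$ (i, j) =
      (\<Sum>l = 0..<m. (A $$ (i,l) - A' $$ (i,l)) * B $$ (l,j) + A' $$ (i,l) * (B $$ (l,j) - B' $$ (l,j)))"
      using ij assms(1-4) by (simp add: scalar_prod_def sum_subtractf[symmetric] algebra_simps)
    also have "\<dots> \<in> I"
      using assms ij by (intro I_sum I_add I_lmult I_rmult) (auto simp: mat_cong_def)
    finally show ?thesis .
  qed
  then show ?thesis using assms(1-4) by (simp add: mat_cong_def)
qed

lemma GL_relD:
  assumes "A \<in> GL_rel n I"
  shows "A \<in> carrier (GL n)" "A \<in> carrier_mat n n" "mat_cong I A (1\<^sub>m n)"
  using assms by (auto simp: GL_rel_def carrier_GL)

lemma GL_rel_one: "1\<^sub>m n \<in> GL_rel n I"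
  by (simp add: GL_rel_def GL_one mat_cong_refl)

lemma GL_rel_mult: "A \<in> GL_rel n I \<Longrightarrow> B \<in> GL_rel n I \<Longrightarrow> A * B \<in> GL_rel n I"
  using mat_cong_mult[of A n n "1\<^sub>m n" B n "1\<^sub>m n"]
  by (auto simp: GL_rel_def GL_mult GL_carrier_mat)

text \<open>\<open>C\<close> is kept apart from \<open>gl_inv n B\<close> so that conjugation in
  either order, by a matrix or by its inverse, is covered without double inverses.\<close>

lemma GL_rel_conj:
  assumes "A \<in> GL_rel n I" "B \<in> carrier (GL n)" "C \<in> carrier_mat n n" "B * C = 1\<^sub>m n"
  shows "B * A * C \<in> GL_rel n I"
proof -
  note A = GL_relD[OF assms(1)]
  have B: "B \<in> carrier_mat n n" using assms(2) by (rule GL_carrier_mat)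
  have C: "C \<in> carrier (GL n)" using B assms(3,4) mat_left_inverse_comm by (intro GL_I[of _ _ B])
  have "mat_cong I (B * A * C) (B * 1\<^sub>m n * C)"
    using A B assms by (intro mat_cong_mult[of _ n n _ _ n] mat_cong_refl) auto
  then show ?thesis using A B C assms by (simp add: GL_rel_def GL_mult)
qed

lemma GL_rel_inv:
  assumes "A \<in> GL_rel n I"
  shows "gl_inv n A \<in> GL_rel n I"
proof -
  note A = GL_relD[OF assms]
  note B = GL_inv_carrier_mat[OF A(1)]
  have "mat_cong I (gl_inv n A * 1\<^sub>m n) (gl_inv n A * A)"
    using A B by (intro mat_cong_mult[of _ n n _ _ n] mat_cong_refl) (auto intro: mat_cong_sym)
  then show ?thesis using A B GL_inv by (simp add: GL_rel_def GL_l_inv)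
qed

lemma Sp_relD:
  assumes "A \<in> Sp_rel \<phi> I" "\<phi> \<in> carrier_mat n n"
  shows "A \<in> GL_rel n I" "A\<^sup>T * \<phi> * A = \<phi>"
  using assms by (auto simp: Sp_rel_def)

lemma Sp_rel_I:
  assumes "A \<in> GL_rel n I" "\<phi> \<in> carrier_mat n n" "A\<^sup>T * \<phi> * A = \<phi>"
  shows "A \<in> Sp_rel \<phi> I"
  using assms by (auto simp: Sp_rel_def)

end

section \<open>Isometries of a bilinear form\<close>

lemma symplectic_mult:
  fixes A B \<phi> :: "'a::comm_ring_1 mat"
  assumes "A \<in> carrier_mat n n" "B \<in> carrier_mat n n" "\<phi> \<in> carrier_mat n n"
    "A\<^sup>T * \<phi> * A = \<phi>" "B\<^sup>T * \<phi> * B = \<phi>"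
  shows "(A * B)\<^sup>T * \<phi> * (A * B) = \<phi>"
proof -
  have "(A * B)\<^sup>T * \<phi> * (A * B) = B\<^sup>T * (A\<^sup>T * \<phi> * A) * B"
    using assms(1-3) by (simp add: transpose_mult[of A n n B n] square_simps[where n = n])
  then show ?thesis using assms by simp
qed

lemma symplectic_inverse:
  fixes A B \<phi> :: "'a::comm_ring_1 mat"
  assumes "A \<in> carrier_mat n n" "B \<in> carrier_mat n n" "\<phi> \<in> carrier_mat n n"
    "A\<^sup>T * \<phi> * A = \<phi>" "A * B = 1\<^sub>m n"
  shows "B\<^sup>T * \<phi> * B = \<phi>"
proof -
  have "B\<^sup>T * \<phi> * B = B\<^sup>T * (A\<^sup>T * \<phi> * A) * B" using assms(4) by simp
  also have "\<dots> = (A * B)\<^sup>T * \<phi> * (A * B)"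
    using assms(1-3) by (simp add: transpose_mult[of A n n B n] square_simps[where n = n])
  finally show ?thesis using assms by simp
qed

text \<open>The form itself provides a left inverse,
  \<open>gl_inv n \<phi> * A\<^sup>T * \<phi>\<close>. This gives invertibility of the Eichler
  matrices and of the block split off from a hyperbolic plane.\<close>

lemma symplectic_GL:
  fixes A \<phi> :: "'a::comm_ring_1 mat"
  assumes A: "A \<in> carrier_mat n n" and \<phi>: "\<phi> \<in> carrier (GL n)" and s: "A\<^sup>T * \<phi> * A = \<phi>"
  shows "A \<in> carrier (GL n)"
proof -
  note p = GL_carrier_mat[OF \<phi>] GL_inv_carrier_mat[OF \<phi>]
  let ?B = "gl_inv n \<phi> * A\<^sup>T * \<phi>"
  have B: "?B \<in> carrier_mat n n" using A p by simp
  have "?B * A = gl_inv n \<phi> * (A\<^sup>T * \<phi> * A)" using A p by (simp add: square_simps[where n = n])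
  then have "?B * A = 1\<^sub>m n" using s GL_l_inv[OF \<phi>] by simp
  then show ?thesis using A B mat_left_inverse_comm by (intro GL_I[of _ _ ?B])
qed

section \<open>Transvections\<close>

lemma row_mult_dim [simp]: "A \<in> carrier_mat m n \<Longrightarrow> row_mult v A \<in> carrier_vec n"
  by (simp add: row_mult_def carrier_vecI)

lemma row_mult_mult:
  assumes "v \<in> carrier_vec n" "A \<in> carrier_mat n n" "B \<in> carrier_mat n n"
  shows "row_mult (row_mult v A) B = row_mult v (A * B)"
  using assms by (simp add: row_mult_def transpose_mult[of A n n B n]
      assoc_mult_mat_vec[of "B\<^sup>T" n n "A\<^sup>T" n v])

lemma row_mult_one [simp]: "v \<in> carrier_vec n \<Longrightarrow> row_mult v (1\<^sub>m n) = v"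
  by (simp add: row_mult_def)

lemma row_mult_index:
  "v \<in> carrier_vec m \<Longrightarrow> A \<in> carrier_mat m n \<Longrightarrow> j < n \<Longrightarrow>
     row_mult v A $ j = (\<Sum>i<m. v $ i * A $$ (i, j))"
  by (simp add: row_mult_def scalar_prod_def lessThan_atLeast0 mult.commute)

lemma sum_unit_left: "i < (n::nat) \<Longrightarrow> (\<Sum>k<n. (if k = i then (1::'a::comm_ring_1) else 0) * f k) = f i"
  by (simp add: if_distrib[of "\<lambda>x. x * _"] sum.delta cong: if_cong)

lemma row_mult_unit: "i < n \<Longrightarrow> A \<in> carrier_mat n n \<Longrightarrow> row_mult (unit_vec n i) A = row A i"
  by (intro eq_vecI) (auto simp: row_mult_index[of _ n _ n] unit_vec_def sum_unit_left)

lemma mult_unit_vec: "i < n \<Longrightarrow> A \<in> carrier_mat n n \<Longrightarrow>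
    A *\<^sub>v unit_vec n i = col (A :: 'a::comm_ring_1 mat) i"
  by (intro eq_vecI) auto

section \<open>Rank one matrices and transvections\<close>

definition outer :: "'a::comm_ring_1 vec \<Rightarrow> 'a vec \<Rightarrow> 'a mat" where
  "outer u w = mat (dim_vec u) (dim_vec w) (\<lambda>(i, j). u $ i * w $ j)"

lemma outer_carrier [simp]: "u \<in> carrier_vec m \<Longrightarrow> w \<in> carrier_vec n \<Longrightarrow> outer u w \<in> carrier_mat m n"
  by (auto simp: outer_def)

lemma outer_index [simp]: "i < dim_vec u \<Longrightarrow> j < dim_vec w \<Longrightarrow> outer u w $$ (i, j) = u $ i * w $ j"
  "dim_row (outer u w) = dim_vec u" "dim_col (outer u w) = dim_vec w"
  by (auto simp: outer_def)

lemma outer_mult_vec: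
  assumes "u \<in> carrier_vec m" "w \<in> carrier_vec n" "x \<in> carrier_vec n"
  shows "outer u w *\<^sub>v x = (w \<bullet> x) \<cdot>\<^sub>v u"
  using assms by (intro eq_vecI) (auto simp: scalar_prod_def sum_distrib_left sum_distrib_right ac_simps)

lemma mat_mult_smult_vec:
  "A \<in> carrier_mat m n \<Longrightarrow> x \<in> carrier_vec n \<Longrightarrow> A *\<^sub>v (a \<cdot>\<^sub>v x) = a \<cdot>\<^sub>v (A *\<^sub>v (x :: 'a::comm_ring_1 vec))"
  by (intro eq_vecI) (auto simp: scalar_prod_def sum_distrib_left ac_simps)

lemma mat_mult_outer:
  assumes "A \<in> carrier_mat k m" "u \<in> carrier_vec m" "w \<in> carrier_vec n"
  shows "A * outer u w = outer (A *\<^sub>v u) w"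
  using assms by (intro eq_matI) (auto simp: scalar_prod_def sum_distrib_left sum_distrib_right ac_simps)

lemma outer_mult_mat:
  assumes "A \<in> carrier_mat n k" "u \<in> carrier_vec m" "w \<in> carrier_vec n"
  shows "outer u w * A = outer u (row_mult w A)"
  using assms by (intro eq_matI)
    (auto simp: row_mult_def scalar_prod_def sum_distrib_left sum_distrib_right ac_simps)

lemma transpose_outer: "(outer u w)\<^sup>T = outer w u"
  by (intro eq_matI) (auto simp: mult.commute)

text \<open>A transvection in the usual sense when \<open>w \<bullet> u = 0\<close>; the condition
  is left to the lemmas, so that the product formulas hold for all vectors.\<close>

definition transv :: "nat \<Rightarrow> 'a::comm_ring_1 vec \<Rightarrow> 'a vec \<Rightarrow> 'a mat" where
  "transv n u w = 1\<^sub>m n + outer u w"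

lemma transv_carrier [simp]:
  "u \<in> carrier_vec n \<Longrightarrow> w \<in> carrier_vec n \<Longrightarrow> transv n u w \<in> carrier_mat n n"
  by (simp add: transv_def)

lemma transv_mult_vec:
  "u \<in> carrier_vec n \<Longrightarrow> w \<in> carrier_vec n \<Longrightarrow> x \<in> carrier_vec n \<Longrightarrow>
    transv n u w *\<^sub>v x = x + (w \<bullet> x) \<cdot>\<^sub>v u"
  by (simp add: transv_def add_mult_distrib_mat_vec[of _ n n] outer_mult_vec[of u n w n x])

lemma row_mult_transv:
  assumes "u \<in> carrier_vec n" "w \<in> carrier_vec n" "x \<in> carrier_vec n"
  shows "row_mult x (transv n u w) = x + (x \<bullet> u) \<cdot>\<^sub>v w"
proof -
  have "(transv n u w)\<^sup>T = transv n w u"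
    using assms by (simp add: transv_def transpose_add[of _ n n] transpose_outer)
  then show ?thesis using assms
    by (simp add: row_mult_def transv_mult_vec comm_scalar_prod[of x n u])
qed

lemma mat_mult_transv:
  assumes "A \<in> carrier_mat n n" "u \<in> carrier_vec n" "w \<in> carrier_vec n"
  shows "A * transv n u w = A + outer (A *\<^sub>v u) w"
  using assms by (simp add: transv_def mult_add_distrib_mat[of A n n _ n] mat_mult_outer[of A n n])

lemma transv_mult_transv:
  assumes "u \<in> carrier_vec n" "w \<in> carrier_vec n" "x \<in> carrier_vec n" "y \<in> carrier_vec n"
  shows "transv n u w * transv n x y = transv n u w + outer (x + (w \<bullet> x) \<cdot>\<^sub>v u) y"
  using assms by (simp add: mat_mult_transv transv_mult_vec)

lemma transv_add_right:
  assumes "u \<in> carrier_vec n" "w \<in> carrier_vec n" "w' \<in> carrier_vec n" "w \<bullet> u = 0"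
  shows "transv n u w * transv n u w' = transv n u (w + w')"
  using assms
  by (subst transv_mult_transv) (auto intro!: eq_matI simp: transv_def algebra_simps)

lemma transv_add_left:
  assumes "u \<in> carrier_vec n" "u' \<in> carrier_vec n" "w \<in> carrier_vec n" "w \<bullet> u' = 0"
  shows "transv n u w * transv n u' w = transv n (u + u') w"
  using assms
  by (subst transv_mult_transv) (auto intro!: eq_matI simp: transv_def algebra_simps)

lemma transv_zero: "u \<in> carrier_vec n \<Longrightarrow> transv n u (0\<^sub>v n) = 1\<^sub>m n"
  by (intro eq_matI) (auto simp: transv_def)

lemma transv_uminus_mult:
  assumes "u \<in> carrier_vec n" "w \<in> carrier_vec n" "w \<bullet> u = 0"
  shows "transv n u w * transv n u (- w) = 1\<^sub>m n" "transv n u (- w) * transv n u w = 1\<^sub>m n"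
proof -
  have "- w \<bullet> u = 0" using assms by simp
  then show "transv n u w * transv n u (- w) = 1\<^sub>m n" "transv n u (- w) * transv n u w = 1\<^sub>m n"
    using assms by (simp_all add: transv_add_right transv_zero)
qed

lemma transv_GL:
  assumes "u \<in> carrier_vec n" "w \<in> carrier_vec n" "w \<bullet> u = 0"
  shows "transv n u w \<in> carrier (GL n)"
  using assms transv_uminus_mult by (intro GL_I[of _ _ "transv n u (- w)"]) auto

text \<open>The two orders of multiplication differ only by \<open>outer p q\<close>, which arises
  from \<open>e \<bullet> e = 1\<close>. The product \<open>?Y * ?X\<close> fixes the row
  \<open>q\<close>, so this difference can be pulled out as the left factor
  \<open>transv n p q\<close>.\<close>

lemma transv_commutator:
  assumes c: "p \<in> carrier_vec n" "q \<in> carrier_vec n" "e \<in> carrier_vec n"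
    and o: "e \<bullet> p = 0" "q \<bullet> e = 0" "q \<bullet> p = 0" "e \<bullet> e = 1"
  shows "transv n p e * transv n e q * (transv n p (- e) * transv n e (- q)) = transv n p q"
proof -
  let ?X = "transv n p e" and ?Y = "transv n e q" and ?X' = "transv n p (- e)" and ?Y' = "transv n e (- q)"
  have YX: "?Y * ?X = transv n e q + outer p e"
    using c o by (simp add: transv_mult_transv) (auto intro!: eq_matI)
  have "?X * ?Y = transv n p e + outer (e + p) q"
    using c o by (simp add: transv_mult_transv)
  also have "\<dots> = (transv n e q + outer p e) + outer p q"
    using c by (intro eq_matI) (auto simp: transv_def algebra_simps)
  also have "\<dots> = transv n p q * (?Y * ?X)"
  proof -
    have "transv n p q * (?Y * ?X) = (?Y * ?X) + outer p q * (?Y * ?X)"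
      using c by (simp add: transv_def[of n p q] add_mult_distrib_mat[of _ n n _ _ n] square_mult_closed
            left_mult_one_mat[of _ n n])
    also have "outer p q * (?Y * ?X) = outer p (row_mult (row_mult q ?Y) ?X)"
      using c by (simp add: outer_mult_mat[of _ n n] row_mult_mult[of _ n] square_mult_closed)
    also have "row_mult (row_mult q ?Y) ?X = q"
    proof -
      have "row_mult q ?Y = q" using c o by (simp add: row_mult_transv) (auto intro!: eq_vecI)
      then show ?thesis using c o by (simp add: row_mult_transv) (auto intro!: eq_vecI)
    qed
    finally show ?thesis using YX by simp
  qed
  finally have "?X * ?Y = transv n p q * (?Y * ?X)" .
  then have "?X * ?Y * (?X' * ?Y') = transv n p q * (?Y * ((?X * ?X') * ?Y'))"
    using c by (simp add: square_simps[where n = n])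
  then show ?thesis using c o
    by (simp add: transv_uminus_mult left_mult_one_mat[of _ n n] right_mult_one_mat[of _ n n])
qed

section \<open>Transvections generated by two opposite parabolics\<close>

lemma scalar_prod_unit_right: "r < n \<Longrightarrow> p \<in> carrier_vec n \<Longrightarrow> p \<bullet> unit_vec n r = (p $ r :: 'a::comm_ring_1)"
  by simp

text \<open>
  \<open>K\<close> contains the parabolic of matrices with first row \<open>e\<^sub>1\<close>, and those elements of the opposite
  parabolic that have first row congruent to \<open>e\<^sub>1\<close>. The row \<open>w\<close> orthogonal to the unimodular
  column \<open>u\<close> is a combination of the Koszul relations between the entries of \<open>u\<close>; only the
  relations involving the first entry leave the second parabolic, and those yield commutators
  because there is a third index.
\<close>

locale parabolic_closed = ring_ideal I for I :: "'a::comm_ring_1 set" +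
  fixes n :: nat and K :: "'a mat set"
  assumes n3: "n \<ge> 3"
    and K_mult: "A \<in> K \<Longrightarrow> B \<in> K \<Longrightarrow> A * B \<in> K"
    and K_col: "g \<in> carrier (GL n) \<Longrightarrow> g *\<^sub>v unit_vec n 0 = unit_vec n 0 \<Longrightarrow>
      (\<And>j. j < n \<Longrightarrow> row_mult (unit_vec n 0) g $ j - unit_vec n 0 $ j \<in> I) \<Longrightarrow> g \<in> K"
    and K_row: "g \<in> carrier (GL n) \<Longrightarrow> row_mult (unit_vec n 0) g = unit_vec n 0 \<Longrightarrow> g \<in> K"
begin

lemma K_transv_col:
  assumes "u \<in> carrier_vec n" "w \<in> carrier_vec n" "w \<bullet> u = 0" "w $ 0 = 0" "u $ 0 \<in> I"
  shows "transv n u w \<in> K"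
proof (rule K_col)
  show "transv n u w \<in> carrier (GL n)" using assms by (simp add: transv_GL)
  show "transv n u w *\<^sub>v unit_vec n 0 = unit_vec n 0"
    using assms n3 by (simp add: transv_mult_vec) (auto intro!: eq_vecI)
  show "row_mult (unit_vec n 0) (transv n u w) $ j - unit_vec n 0 $ j \<in> I" if "j < n" for j
    using assms n3 that by (simp add: row_mult_transv I_rmult)
qed

lemma K_transv_row:
  assumes "u \<in> carrier_vec n" "w \<in> carrier_vec n" "w \<bullet> u = 0" "u $ 0 = 0"
  shows "transv n u w \<in> K"
proof (rule K_row)
  show "transv n u w \<in> carrier (GL n)" using assms by (simp add: transv_GL)
  show "row_mult (unit_vec n 0) (transv n u w) = unit_vec n 0"
    using assms n3 by (simp add: row_mult_transv) (auto intro!: eq_vecI)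
qed

text \<open>An index \<open>r\<close> at which both vectors vanish makes the transvection a
  commutator through \<open>unit_vec n r\<close>. The factors with \<open>p\<close> fix the first
  unit column, and \<open>p $ 0 \<in> I\<close> gives their congruence; the factors with
  \<open>q\<close> fix the first unit row because \<open>r \<noteq> 0\<close>.\<close>

lemma K_transv_commutator:
  assumes c: "p \<in> carrier_vec n" "q \<in> carrier_vec n"
    and r: "r < n" "r \<noteq> 0" "p $ r = 0" "q $ r = 0"
    and o: "q \<bullet> p = 0" "p $ 0 \<in> I"
  shows "transv n p q \<in> K"
proof -
  let ?e = "unit_vec n r :: 'a vec"
  have e: "?e \<bullet> p = 0" "q \<bullet> ?e = 0" "?e \<bullet> ?e = 1" "?e $ 0 = 0"
    using c r n3 by simp_all
  have "transv n p ?e \<in> K" "transv n p (- ?e) \<in> K"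
    using c o e n3 by (auto intro!: K_transv_col)
  moreover have "transv n ?e q \<in> K" "transv n ?e (- q) \<in> K"
    using c o e n3 by (auto intro!: K_transv_row)
  ultimately have "transv n p ?e * transv n ?e q * (transv n p (- ?e) * transv n ?e (- q)) \<in> K"
    by (intro K_mult)
  then show ?thesis using transv_commutator[OF c, of ?e] e o by simp
qed

text \<open>The part \<open>u'\<close> of \<open>u\<close> away from \<open>0\<close> and
  \<open>l\<close> is orthogonal to \<open>q\<close> because the supports are disjoint, and its
  first entry is 0, so it falls under the row parabolic. The remaining part \<open>p\<close> is
  supported on the same two indices as \<open>q\<close>.\<close>

lemma K_transv_two_entries:
  assumes c: "u \<in> carrier_vec n" "q \<in> carrier_vec n" and l: "l < n" "l \<noteq> 0"
    and q: "\<And>i. i < n \<Longrightarrow> i \<noteq> 0 \<Longrightarrow> i \<noteq> l \<Longrightarrow> q $ i = 0" and o: "q \<bullet> u = 0" "u $ 0 \<in> I"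
  shows "transv n u q \<in> K"
proof -
  define p where "p = vec n (\<lambda>i. if i = 0 \<or> i = l then u $ i else 0)"
  define u' where "u' = vec n (\<lambda>i. if i = 0 \<or> i = l then 0 else u $ i)"
  have pu: "p \<in> carrier_vec n" "u' \<in> carrier_vec n" "p + u' = u"
    using c by (auto simp: p_def u'_def intro!: eq_vecI)
  have qu': "q \<bullet> u' = 0" using c q by (auto simp: scalar_prod_def u'_def intro!: sum.neutral)
  have "q \<bullet> p + q \<bullet> u' = q \<bullet> u"
    using scalar_prod_add_distrib[of q n p u'] c pu by simp
  then have qp: "q \<bullet> p = 0" using qu' o by simp
  \<comment> \<open>\<open>n \<ge> 3\<close> leaves an index outside \<open>{0, l}\<close>.\<close>
  define r :: nat where "r = (if l = 1 then 2 else 1)"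
  have r: "r < n" "r \<noteq> 0" "r \<noteq> l" using n3 by (auto simp: r_def)
  have "transv n p q \<in> K"
    using c pu r q qp o n3 by (intro K_transv_commutator[of p q r]) (auto simp: p_def)
  moreover have "transv n u' q \<in> K"
    using c pu qu' n3 by (intro K_transv_row) (auto simp: u'_def)
  ultimately show ?thesis using K_mult transv_add_left[of p n u' q] c pu qu' by metis
qed

text \<open>\<open>Q S\<close> is the sum over \<open>l \<in> S\<close> of \<open>c l\<close> times
  the Koszul relation with entry \<open>u $ l\<close> at 0 and \<open>- u $ 0\<close> at
  \<open>l\<close>. Each relation is orthogonal to \<open>u\<close>, so the transvections multiply
  additively and the relations can be adjoined one at a time. The factor \<open>a\<close> puts the
  first entry of the column into \<open>I\<close>.\<close>

lemma K_transv_sum: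
  fixes c :: "nat \<Rightarrow> 'a"
  assumes u: "u \<in> carrier_vec n" and a: "a \<in> I" and S: "finite S" "S \<subseteq> {1..<n}"
  defines "Q \<equiv> \<lambda>S. vec n (\<lambda>i. if i = 0 then \<Sum>l\<in>S. c l * u $ l
                             else if i \<in> S then - (c i * u $ 0) else 0)"
  shows "transv n (a \<cdot>\<^sub>v u) (Q S) \<in> K \<and> Q S \<bullet> u = 0"
  using S
proof (induct S rule: finite_induct)
  case empty
  have "Q {} = 0\<^sub>v n" by (auto simp: Q_def)
  moreover have "transv n (a \<cdot>\<^sub>v u) (0\<^sub>v n) \<in> K"
    using u a n3 by (intro K_transv_col) (auto simp: I_rmult)
  ultimately show ?case using u by simp
next
  case (insert l S)
  then have IH: "transv n (a \<cdot>\<^sub>v u) (Q S) \<in> K" "Q S \<bullet> u = 0" and l: "l < n" "l \<noteq> 0" "l \<notin> S" by auto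
  define q where "q = vec n (\<lambda>i. if i = 0 then c l * u $ l else if i = l then - (c l * u $ 0) else 0)"
  have q: "q \<in> carrier_vec n" "Q S \<in> carrier_vec n" by (auto simp: q_def Q_def)
  have "q \<bullet> u = (\<Sum>i\<in>{0, l}. q $ i * u $ i)"
    unfolding scalar_prod_def using u l n3 by (intro sum.mono_neutral_right) (auto simp: q_def)
  also have "\<dots> = 0" using l n3 by (simp add: q_def)
  finally have qu: "q \<bullet> u = 0" .
  have sum: "Q (insert l S) = Q S + q"
    using l insert(1) by (intro eq_vecI) (auto simp: Q_def q_def)
  have "transv n (a \<cdot>\<^sub>v u) q \<in> K"
    using u a q l qu n3 by (intro K_transv_two_entries[of _ q l]) (auto simp: q_def I_rmult)
  then have "transv n (a \<cdot>\<^sub>v u) (Q S + q) \<in> K"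
    using K_mult[OF IH(1)] transv_add_right[of "a \<cdot>\<^sub>v u" n "Q S" q] u q IH(2) by fastforce
  then show ?case using sum q u qu IH by (simp add: add_scalar_prod_distrib[of _ n])
qed

text \<open>Because \<open>p \<bullet> u = 1\<close> and \<open>w \<bullet> u = 0\<close>, the row
  \<open>w\<close> is the combination of the Koszul relations between \<open>i\<close> and
  \<open>l\<close> with coefficients \<open>p $ l * w $ i - p $ i * w $ l\<close>. \<open>Q\<close>
  collects those with \<open>i = 0\<close>. It already has the first entry of \<open>w\<close>, so
  \<open>w - Q\<close> vanishes there and its transvection fixes the first unit column.\<close>

lemma K_transv:
  assumes c: "u \<in> carrier_vec n" "w \<in> carrier_vec n" "p \<in> carrier_vec n"
    and o: "w \<bullet> u = 0" "p \<bullet> u = 1" and a: "a \<in> I"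
  shows "transv n (a \<cdot>\<^sub>v u) w \<in> K"
proof -
  define Q where "Q = vec n (\<lambda>i. if i = 0 then \<Sum>l\<in>{1..<n}. (p $ l * w $ 0 - p $ 0 * w $ l) * u $ l
      else if i \<in> {1..<n} then - ((p $ i * w $ 0 - p $ 0 * w $ i) * u $ 0) else 0)"
  have n0: "{0..<n} = insert 0 {1..<n}" using n3 by auto
  have wu: "w $ 0 * u $ 0 + (\<Sum>l\<in>{1..<n}. w $ l * u $ l) = 0"
    and pu: "p $ 0 * u $ 0 + (\<Sum>l\<in>{1..<n}. p $ l * u $ l) = 1"
    using o c n0 by (simp_all add: scalar_prod_def)
  have Q0: "Q $ 0 = w $ 0"
  proof -
    have "Q $ 0 = (\<Sum>l\<in>{1..<n}. w $ 0 * (p $ l * u $ l) - p $ 0 * (w $ l * u $ l))"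
      using n3 by (simp add: Q_def algebra_simps)
    also have "\<dots> = w $ 0 * (\<Sum>l\<in>{1..<n}. p $ l * u $ l) - p $ 0 * (\<Sum>l\<in>{1..<n}. w $ l * u $ l)"
      by (simp add: sum_subtractf sum_distrib_left)
    also have "\<dots> = w $ 0 * (1 - p $ 0 * u $ 0) - p $ 0 * (- (w $ 0 * u $ 0))"
    proof -
      have "(\<Sum>l\<in>{1..<n}. p $ l * u $ l) = 1 - p $ 0 * u $ 0"
        using pu by (simp add: eq_diff_eq add.commute)
      moreover have "(\<Sum>l\<in>{1..<n}. w $ l * u $ l) = - (w $ 0 * u $ 0)"
        using wu by (simp add: eq_neg_iff_add_eq_0 add.commute)
      ultimately show ?thesis by simp
    qed
    finally show ?thesis by (simp add: algebra_simps)
  qed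
  have Qc: "Q \<in> carrier_vec n" by (simp add: Q_def)
  have K: "transv n (a \<cdot>\<^sub>v u) Q \<in> K" and Qu: "Q \<bullet> u = 0"
    using K_transv_sum[OF c(1) a, of "{1..<n}" "\<lambda>l. p $ l * w $ 0 - p $ 0 * w $ l"]
    unfolding Q_def by simp_all
  have "w - Q \<in> carrier_vec n" "(w - Q) \<bullet> (a \<cdot>\<^sub>v u) = 0" "(w - Q) $ 0 = 0"
    using c Qc Qu o Q0 n3 by (simp_all add: minus_scalar_prod_distrib[of _ n])
  then have "transv n (a \<cdot>\<^sub>v u) (w - Q) \<in> K"
    using c a n3 by (intro K_transv_col) (auto simp: I_rmult)
  then have "transv n (a \<cdot>\<^sub>v u) Q * transv n (a \<cdot>\<^sub>v u) (w - Q) \<in> K" using K K_mult by blast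
  then have "transv n (a \<cdot>\<^sub>v u) (Q + (w - Q)) \<in> K"
    using transv_add_right[of "a \<cdot>\<^sub>v u" n Q "w - Q"] c Qc Qu by simp
  moreover have "Q + (w - Q) = w" using c Qc by (intro eq_vecI) auto
  ultimately show ?thesis by simp
qed

end

section \<open>Elementary groups\<close>

lemma elem_mat_carrier [simp]: "elem_mat n i j a \<in> carrier_mat n n"
  by (simp add: elem_mat_def mat_unit_def)

lemma elem_mat_dim [simp]: "dim_row (elem_mat n i j a) = n" "dim_col (elem_mat n i j a) = n"
  by (simp_all add: elem_mat_def mat_unit_def)

lemma elem_mat_index:
  "k < n \<Longrightarrow> l < n \<Longrightarrow> elem_mat n i j a $$ (k, l) =
     (if k = l then 1 else 0) + (if k = i \<and> l = j then a else 0)"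
  by (auto simp: elem_mat_def mat_unit_def)

lemma elem_mat_eq_transv:
  "i < n \<Longrightarrow> j < n \<Longrightarrow> elem_mat n i j a = transv n (a \<cdot>\<^sub>v unit_vec n i) (unit_vec n j)"
  by (intro eq_matI) (auto simp: elem_mat_index transv_def unit_vec_def)

lemma elem_mat_mult_uminus:
  assumes "i < n" "j < n" "i \<noteq> j"
  shows "elem_mat n i j a * elem_mat n i j (- a) = (1\<^sub>m n :: 'a::comm_ring_1 mat)"
proof -
  have "elem_mat n i j (- a) = transv n (a \<cdot>\<^sub>v unit_vec n i) (- unit_vec n j)"
    using assms by (intro eq_matI) (auto simp: elem_mat_index transv_def unit_vec_def)
  then show ?thesis using assms by (simp add: elem_mat_eq_transv transv_uminus_mult)
qed

lemma elem_mat_GL: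
  assumes "i < n" "j < n" "i \<noteq> j"
  shows "elem_mat n i j a \<in> carrier (GL n)"
  using elem_mat_mult_uminus[OF assms, of a] elem_mat_mult_uminus[OF assms, of "- a"]
  by (intro GL_I[of _ _ "elem_mat n i j (- a)"]) auto

lemma elem_mat_inv:
  assumes "i < n" "j < n" "i \<noteq> j"
  shows "gl_inv n (elem_mat n i j a) = elem_mat n i j (- a)"
  using elem_mat_mult_uminus[OF assms, of a] elem_mat_mult_uminus[OF assms, of "- a"]
  by (intro GL_inv_eq) auto

lemma det_elem_mat: "i < n \<Longrightarrow> i \<noteq> j \<Longrightarrow> det (elem_mat n i j a) = 1"
proof -
  assume "i < n" "i \<noteq> j"
  moreover have "elem_mat n i j a = addrow_mat n a i j"
    by (intro eq_matI) (auto simp: elem_mat_index addrow_mat_def)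
  ultimately show ?thesis by (simp add: det_addrow_mat)
qed

lemma E_abs_subgroup: "subgroup (E_abs n) (GL n)"
  unfolding E_abs_def
proof (rule group.generate_is_subgroup[OF group_GL], rule subsetI)
  fix A :: "'a mat"
  assume "A \<in> {elem_mat n i j a |i j a. i < n \<and> j < n \<and> i \<noteq> j}"
  then show "A \<in> carrier (GL n)" by (elim CollectE exE conjE) (simp add: elem_mat_GL)
qed

lemma E_abs_GL: "A \<in> E_abs n \<Longrightarrow> A \<in> carrier (GL n)"
  by (rule subgroup.mem_carrier[OF E_abs_subgroup])

lemma E_abs_mult: "A \<in> E_abs n \<Longrightarrow> B \<in> E_abs n \<Longrightarrow> A * B \<in> E_abs n"
  using subgroup.m_closed[OF E_abs_subgroup, of A n B] by simp

lemma E_abs_one: "1\<^sub>m n \<in> E_abs n"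
  using subgroup.one_closed[OF E_abs_subgroup, of n] by simp

lemma elem_mat_E_abs: "i < n \<Longrightarrow> j < n \<Longrightarrow> i \<noteq> j \<Longrightarrow> elem_mat n i j a \<in> E_abs n"
  unfolding E_abs_def by (rule generate.incl) blast

lemma E_abs_induct [consumes 1, case_names one elem mult]:
  assumes "A \<in> E_abs n" "P (1\<^sub>m n)"
    and "\<And>i j a. i < n \<Longrightarrow> j < n \<Longrightarrow> i \<noteq> j \<Longrightarrow> P (elem_mat n i j a)"
    and "\<And>A B. A \<in> E_abs n \<Longrightarrow> B \<in> E_abs n \<Longrightarrow> P A \<Longrightarrow> P B \<Longrightarrow> P (A * B)"
  shows "P A"
  using assms(1) unfolding E_abs_def
proof (induct rule: generate.induct)
  case (eng h1 h2)
  then show ?case using assms(4)[of h1 h2] by (simp add: E_abs_def)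
next
  case (inv h)
  then show ?case using assms(3) by (elim CollectE exE conjE) (simp add: elem_mat_inv)
qed (use assms(2,3) in auto)

lemma E_rel_subgroup: "subgroup (E_rel n I) (GL n)"
  unfolding E_rel_def
proof (rule group.generate_is_subgroup[OF group_GL], rule subsetI)
  fix A :: "'a mat"
  assume "A \<in> {\<alpha> * elem_mat n i j a * gl_inv n \<alpha> |\<alpha> i j a.
    \<alpha> \<in> E_abs n \<and> i < n \<and> j < n \<and> i \<noteq> j \<and> a \<in> I}"
  then show "A \<in> carrier (GL n)" by (elim CollectE exE conjE) (simp add: elem_mat_GL GL_mult GL_inv E_abs_GL)
qed

lemma E_rel_GL: "A \<in> E_rel n I \<Longrightarrow> A \<in> carrier (GL n)"
  by (rule subgroup.mem_carrier[OF E_rel_subgroup])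

lemma E_rel_carrier_mat: "A \<in> E_rel n I \<Longrightarrow> A \<in> carrier_mat n n"
  by (rule GL_carrier_mat[OF E_rel_GL])

lemma E_rel_mult: "A \<in> E_rel n I \<Longrightarrow> B \<in> E_rel n I \<Longrightarrow> A * B \<in> E_rel n I"
  using subgroup.m_closed[OF E_rel_subgroup, of A n I B] by simp

lemma E_rel_one: "1\<^sub>m n \<in> E_rel n I"
  using subgroup.one_closed[OF E_rel_subgroup, of n] by simp

lemma E_rel_inv: "A \<in> E_rel n I \<Longrightarrow> gl_inv n A \<in> E_rel n I"
  by (rule subgroup.m_inv_closed[OF E_rel_subgroup])

lemma E_rel_gen:
  "\<alpha> \<in> E_abs n \<Longrightarrow> i < n \<Longrightarrow> j < n \<Longrightarrow> i \<noteq> j \<Longrightarrow> a \<in> I \<Longrightarrow>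
    \<alpha> * elem_mat n i j a * gl_inv n \<alpha> \<in> E_rel n I"
  unfolding E_rel_def by (rule generate.incl) blast

lemma elem_mat_E_rel:
  fixes a :: "'a::comm_ring_1"
  shows "i < n \<Longrightarrow> j < n \<Longrightarrow> i \<noteq> j \<Longrightarrow> a \<in> I \<Longrightarrow> elem_mat n i j a \<in> E_rel n I"
  using E_rel_gen[OF E_abs_one, of i n j a I]
    GL_inv_eq[of "1\<^sub>m n :: 'a mat" n "1\<^sub>m n"] by simp

context ring_ideal
begin

text \<open>The inverse of a conjugated generator is the same conjugate with \<open>- a\<close>, so
  inverses require no case of their own and the rule applies to predicates that are merely
  multiplicative, such as membership in a \<open>K\<close> as above.\<close>

lemma E_rel_induct [consumes 1, case_names one gen mult]:
  assumes "A \<in> E_rel n I" "P (1\<^sub>m n)"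
    and gen: "\<And>\<alpha> i j a. \<alpha> \<in> E_abs n \<Longrightarrow> i < n \<Longrightarrow> j < n \<Longrightarrow> i \<noteq> j \<Longrightarrow> a \<in> I \<Longrightarrow>
      P (\<alpha> * elem_mat n i j a * gl_inv n \<alpha>)"
    and "\<And>A B. A \<in> E_rel n I \<Longrightarrow> B \<in> E_rel n I \<Longrightarrow> P A \<Longrightarrow> P B \<Longrightarrow> P (A * B)"
  shows "P A"
  using assms(1) unfolding E_rel_def
proof (induct rule: generate.induct)
  case (inv h)
  then obtain \<alpha> i j a where h: "\<alpha> \<in> E_abs n" "i < n" "j < n" "i \<noteq> j" "a \<in> I"
    "h = \<alpha> * elem_mat n i j a * gl_inv n \<alpha>" by blast
  have "gl_inv n h = \<alpha> * elem_mat n i j (- a) * gl_inv n \<alpha>"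
    using h E_abs_GL[OF h(1)] GL_carrier_mat[OF E_abs_GL[OF h(1)]]
      GL_inv_carrier_mat[OF E_abs_GL[OF h(1)]]
    by (simp add: GL_inv_mult GL_mult GL_inv GL_inv_inv elem_mat_GL elem_mat_inv square_simps[where n = n])
  then show ?case using gen[OF h(1-4)] h(5) I_uminus by metis
next
  case (eng h1 h2)
  then show ?case using assms(4)[of h1 h2] by (simp add: E_rel_def)
qed (use assms(2) gen in auto)

lemma elem_mat_cong: "a \<in> I \<Longrightarrow> mat_cong I (elem_mat n i j a) (1\<^sub>m n)"
  by (auto simp: mat_cong_def elem_mat_index I_zero)

lemma E_rel_SL_rel:
  assumes "A \<in> E_rel n I"
  shows "A \<in> SL_rel n I"
  using assms
proof (induct rule: E_rel_induct)
  case one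
  then show ?case by (simp add: SL_rel_def GL_rel_one)
next
  case (gen \<alpha> i j a)
  have \<alpha>: "\<alpha> \<in> carrier (GL n)" using gen(1) by (rule E_abs_GL)
  note c = GL_carrier_mat[OF \<alpha>] GL_inv_carrier_mat[OF \<alpha>]
  have "elem_mat n i j a \<in> GL_rel n I"
    using gen by (simp add: GL_rel_def elem_mat_GL elem_mat_cong)
  then have "\<alpha> * elem_mat n i j a * gl_inv n \<alpha> \<in> GL_rel n I"
    by (rule GL_rel_conj) (use \<alpha> c in \<open>auto simp: GL_r_inv\<close>)
  moreover have "det \<alpha> * det (gl_inv n \<alpha>) = 1"
    using det_mult[OF c] GL_r_inv[OF \<alpha>] by simp
  then have "det (\<alpha> * elem_mat n i j a * gl_inv n \<alpha>) = 1"
    using gen c by (simp add: det_mult[of _ n] square_mult_closed det_elem_mat)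
  ultimately show ?case by (simp add: SL_rel_def)
next
  case (mult A B)
  then show ?case
    by (auto simp: SL_rel_def GL_rel_mult det_mult[of _ n] E_rel_carrier_mat)
qed

text \<open>This permits conjugation by matrices that are not congruent to the identity, as the
  Whitehead factorization requires.\<close>

lemma E_rel_conj:
  assumes "x \<in> E_rel n I" and \<beta>: "\<beta> \<in> E_abs n"
  shows "\<beta> * x * gl_inv n \<beta> \<in> E_rel n I"
  using assms(1)
proof (induct rule: E_rel_induct)
  case one
  then show ?case using GL_r_inv[OF E_abs_GL[OF \<beta>]] GL_carrier_mat[OF E_abs_GL[OF \<beta>]]
    by (simp add: E_rel_one)
next
  case (gen \<alpha> i j a)
  note g = E_abs_GL[OF gen(1)] E_abs_GL[OF \<beta>]
  note c = GL_carrier_mat[OF g(1)] GL_inv_carrier_mat[OF g(1)] GL_carrier_mat[OF g(2)] GL_inv_carrier_mat[OF g(2)]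
  have "\<beta> * (\<alpha> * elem_mat n i j a * gl_inv n \<alpha>) * gl_inv n \<beta> =
      (\<beta> * \<alpha>) * elem_mat n i j a * gl_inv n (\<beta> * \<alpha>)"
    using g c by (simp add: GL_inv_mult square_simps[where n = n])
  then show ?case using gen \<beta> by (simp add: E_rel_gen E_abs_mult)
next
  case (mult A B)
  note g = E_abs_GL[OF \<beta>]
  note c = GL_carrier_mat[OF g] GL_inv_carrier_mat[OF g] E_rel_carrier_mat[OF mult(1)] E_rel_carrier_mat[OF mult(2)]
  have "(\<beta> * A * gl_inv n \<beta>) * (\<beta> * (B * gl_inv n \<beta>)) = (\<beta> * A) * (B * gl_inv n \<beta>)"
    using c GL_l_inv[OF g] by (intro mult_cancel_mid) (auto simp: square_mult_closed)
  then have "(\<beta> * A * gl_inv n \<beta>) * (\<beta> * B * gl_inv n \<beta>) = \<beta> * (A * B) * gl_inv n \<beta>"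
    using c by (simp add: square_simps[where n = n])
  then show ?case using E_rel_mult[OF mult(3,4)] by simp
qed

end

lemma row_mult_scalar:
  "v \<in> carrier_vec n \<Longrightarrow> A \<in> carrier_mat n n \<Longrightarrow> x \<in> carrier_vec n \<Longrightarrow>
    row_mult v A \<bullet> x = v \<bullet> (A *\<^sub>v (x :: 'a::comm_ring_1 vec))"
  unfolding row_mult_def by (rule transpose_vec_mult_scalar)

lemma transv_conj:
  assumes "A \<in> carrier_mat n n" "B \<in> carrier_mat n n" "A * B = 1\<^sub>m n"
    "u \<in> carrier_vec n" "w \<in> carrier_vec n"
  shows "A * transv n u w * B = transv n (A *\<^sub>v u) (row_mult w B)"
proof -
  have "A * transv n u w * B = A * B + outer (A *\<^sub>v u) w * B"
    using assms by (simp add: mat_mult_transv add_mult_distrib_mat[of _ n n _ _ n])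
  then show ?thesis using assms
    by (simp add: transv_def outer_mult_mat[of B n n _ n] mult_mat_vec_carrier[of A n n])
qed

context parabolic_closed
begin

text \<open>A generator is a transvection with column \<open>?u\<close> scaled by \<open>a\<close>
  and row \<open>?w j\<close>. The row \<open>?w i\<close> pairs to 1 with \<open>?u\<close>, which
  is the unimodularity demanded by \<open>K_transv\<close>.\<close>

lemma E_rel_subset: "E_rel n I \<subseteq> K"
proof
  fix x assume "x \<in> E_rel n I"
  then show "x \<in> K"
  proof (induct rule: E_rel_induct)
    case one
    show ?case using K_row[OF GL_one] by simp
  next
    case (gen \<alpha> i j a)
    have g: "\<alpha> \<in> carrier (GL n)" using gen(1) by (rule E_abs_GL)
    note c = GL_carrier_mat[OF g] GL_inv_carrier_mat[OF g]
    let ?u = "\<alpha> *\<^sub>v unit_vec n i" and ?w = "\<lambda>j. row_mult (unit_vec n j) (gl_inv n \<alpha>)"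
    have wu: "?w k \<bullet> ?u = unit_vec n k \<bullet> unit_vec n i" for k
      using c assoc_mult_mat_vec[OF c(2,1), of "unit_vec n i"]
      by (simp add: row_mult_scalar[of _ n] GL_l_inv[OF g])
    have "\<alpha> * elem_mat n i j a * gl_inv n \<alpha> = transv n (a \<cdot>\<^sub>v ?u) (?w j)"
      using gen c GL_r_inv[OF g] by (simp add: elem_mat_eq_transv transv_conj mat_mult_smult_vec[OF c(1)])
    moreover have "transv n (a \<cdot>\<^sub>v ?u) (?w j) \<in> K"
      using gen c wu scalar_prod_unit_right[of i n "unit_vec n _ :: 'a vec"]
      by (intro K_transv[of _ _ "?w i"]) auto
    ultimately show ?case by simp
  qed (rule K_mult)
qed

end

section \<open>Symplectic orbits of the first unit row\<close>

text \<open>The diagonal has a hypothesis of its own because 2 may be a zero divisor: the second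
  hypothesis with \<open>i = j\<close> only says that twice the entry is 0.\<close>

lemma sum_alternating_zero:
  fixes f :: "nat \<Rightarrow> nat \<Rightarrow> 'a::comm_ring_1"
  assumes "\<And>i. i < n \<Longrightarrow> f i i = 0" "\<And>i j. i < n \<Longrightarrow> j < n \<Longrightarrow> f i j + f j i = 0"
  shows "(\<Sum>i<n. \<Sum>j<n. f i j) = 0"
  using assms
proof (induct n)
  case (Suc n)
  have "(\<Sum>i<Suc n. \<Sum>j<Suc n. f i j) = (\<Sum>i<n. \<Sum>j<n. f i j) + (\<Sum>i<n. f i n + f n i) + f n n"
    by (simp add: sum.distrib algebra_simps)
  also have "(\<Sum>i<n. f i n + f n i) = 0" using Suc.prems by (intro sum.neutral) auto
  finally show ?case using Suc by simp
qed simp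

section \<open>Eichler transformations of an alternating form\<close>

locale alternating_form =
  fixes n :: nat and \<phi> :: "'a::comm_ring_1 mat"
  assumes \<phi>_GL: "\<phi> \<in> carrier (GL n)" and alternating: "alternating_mat \<phi>" and n_pos: "n > 0"
begin

lemmas \<phi>_carrier = GL_carrier_mat[OF \<phi>_GL]
  and \<psi>_carrier = GL_inv_carrier_mat[OF \<phi>_GL]

lemma \<phi>_index: "i < n \<Longrightarrow> j < n \<Longrightarrow> \<phi> $$ (j, i) = - \<phi> $$ (i, j)" "i < n \<Longrightarrow> \<phi> $$ (i, i) = 0"
proof -
  have "\<phi>\<^sup>T = - \<phi>" "\<forall>i<n. \<phi> $$ (i, i) = 0"
    using alternating \<phi>_carrier by (auto simp: alternating_mat_def)
  then show "i < n \<Longrightarrow> j < n \<Longrightarrow> \<phi> $$ (j, i) = - \<phi> $$ (i, j)" "i < n \<Longrightarrow> \<phi> $$ (i, i) = 0"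
    using \<phi>_carrier
    by (metis carrier_matD index_transpose_mat(1) index_uminus_mat(1), simp)
qed

lemma mult_vec_skew: "x \<in> carrier_vec n \<Longrightarrow> \<phi> *\<^sub>v x = - row_mult x \<phi>"
proof -
  assume x: "x \<in> carrier_vec n"
  have "\<phi>\<^sup>T = - \<phi>" using alternating by (simp add: alternating_mat_def)
  then show ?thesis using x \<phi>_carrier by (intro eq_vecI) (auto simp: row_mult_def)
qed

lemma isotropic:
  assumes "x \<in> carrier_vec n"
  shows "row_mult x \<phi> \<bullet> x = 0"
proof -
  have "row_mult x \<phi> \<bullet> x = (\<Sum>i<n. \<Sum>j<n. x $ j * \<phi> $$ (j, i) * x $ i)"
    using assms \<phi>_carrier
    by (auto simp: scalar_prod_def row_mult_index[of _ n _ n] sum_distrib_right lessThan_atLeast0)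
  also have "\<dots> = 0"
  proof (rule sum_alternating_zero)
    fix i j assume "i < n" "j < n"
    then show "x $ j * \<phi> $$ (j, i) * x $ i + x $ i * \<phi> $$ (i, j) * x $ j = 0"
      using \<phi>_index(1)[of i j] by (simp add: algebra_simps)
  qed (simp add: \<phi>_index(2))
  finally show ?thesis .
qed

text \<open>Eichler transformation: writing B(y, x) for the value of the form, it sends x to x +
  B(d, x) a + B(a, x) d - c B(a, x) a. The last term is a symplectic transvection along
  \<open>a\<close>, and \<open>c\<close> is a free parameter with which a row or a column can be
  corrected.\<close>

definition eichler :: "'a vec \<Rightarrow> 'a vec \<Rightarrow> 'a \<Rightarrow> 'a mat" where
  "eichler a d c = 1\<^sub>m n + outer a (row_mult d \<phi> - c \<cdot>\<^sub>v row_mult a \<phi>) + outer d (row_mult a \<phi>)"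

lemma eichler_carrier [simp]:
  "a \<in> carrier_vec n \<Longrightarrow> d \<in> carrier_vec n \<Longrightarrow> eichler a d c \<in> carrier_mat n n"
  using \<phi>_carrier by (simp add: eichler_def)

lemma eichler_symplectic:
  assumes c: "a \<in> carrier_vec n" "d \<in> carrier_vec n" and o: "row_mult a \<phi> \<bullet> d = 0"
  shows "(eichler a d c)\<^sup>T * \<phi> * eichler a d c = \<phi>"
proof -
  define \<alpha> where "\<alpha> = row_mult a \<phi>"
  define \<delta> where "\<delta> = row_mult d \<phi>"
  define \<beta> where "\<beta> = \<delta> - c \<cdot>\<^sub>v \<alpha>"
  have v: "\<alpha> \<in> carrier_vec n" "\<delta> \<in> carrier_vec n" "\<beta> \<in> carrier_vec n"
    using \<phi>_carrier by (auto simp: \<alpha>_def \<delta>_def \<beta>_def)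
  have \<phi>a: "\<phi> *\<^sub>v a = - \<alpha>" "\<phi> *\<^sub>v d = - \<delta>" using c by (simp_all add: \<alpha>_def \<delta>_def mult_vec_skew)
  have "\<delta> \<bullet> a = d \<bullet> (\<phi> *\<^sub>v a)" using c \<phi>_carrier by (simp add: \<delta>_def row_mult_scalar)
  also have "\<dots> = - (\<alpha> \<bullet> d)" using c v by (simp add: \<phi>a comm_scalar_prod[of d n])
  \<comment> \<open>All pairings among \<open>a\<close> and \<open>d\<close> vanish, so
    \<open>X\<close> acts on them as \<phi> does; in \<open>X * s\<close> the remaining rank one
    terms cancel, those with \<open>c\<close> included.\<close>
  finally have z: "\<delta> \<bullet> a = 0" "\<alpha> \<bullet> d = 0" "\<alpha> \<bullet> a = 0" "\<delta> \<bullet> d = 0"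
    using o c by (simp_all add: \<alpha>_def \<delta>_def isotropic)
  define s where "s = 1\<^sub>m n + outer a \<beta> + outer d \<alpha>"
  have s: "s \<in> carrier_mat n n" "s = eichler a d c"
    using c v by (simp_all add: s_def eichler_def \<alpha>_def \<beta>_def \<delta>_def)
  define X where "X = \<phi> + outer \<beta> \<alpha> + outer \<alpha> \<delta>"
  have X: "X \<in> carrier_mat n n" using v \<phi>_carrier by (simp add: X_def)
  have "s\<^sup>T = 1\<^sub>m n + outer \<beta> a + outer \<alpha> d"
    using c v by (simp add: s_def transpose_add[of _ n n] transpose_outer)
  then have sX: "s\<^sup>T * \<phi> = X"
    using c v \<phi>_carrier
    by (simp add: X_def add_mult_distrib_mat[of _ n n _ _ n] outer_mult_mat[of \<phi> n n _ n]
        \<alpha>_def[symmetric] \<delta>_def[symmetric])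
  have Xa: "X *\<^sub>v a = - \<alpha>" "X *\<^sub>v d = - \<delta>"
    using c v \<phi>_carrier z
    by (auto simp: X_def add_mult_distrib_mat_vec[of _ n n] outer_mult_vec[of _ n _ n] \<phi>a intro!: eq_vecI)
  have "X * s = X + outer (X *\<^sub>v a) \<beta> + outer (X *\<^sub>v d) \<alpha>"
    using c v X by (simp add: s_def mult_add_distrib_mat[of X n n _ n] mat_mult_outer[of X n n])
  also have "\<dots> = \<phi>"
    unfolding Xa unfolding X_def using v \<phi>_carrier
    by (intro eq_matI) (auto simp: \<beta>_def algebra_simps)
  finally show ?thesis using sX s by simp
qed

lemma row_mult_eichler:
  assumes "a \<in> carrier_vec n" "d \<in> carrier_vec n"
  shows "row_mult (unit_vec n 0) (eichler a d c) =
    unit_vec n 0 + a $ 0 \<cdot>\<^sub>v (row_mult d \<phi> - c \<cdot>\<^sub>v row_mult a \<phi>) + d $ 0 \<cdot>\<^sub>v row_mult a \<phi>"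
  using assms n_pos eichler_carrier[OF assms, of c] \<phi>_carrier
  by (subst row_mult_unit) (auto intro!: eq_vecI simp: eichler_def carrier_vecD[OF row_mult_dim[OF \<phi>_carrier]])

lemma eichler_mult_unit:
  assumes "a \<in> carrier_vec n" "d \<in> carrier_vec n"
  shows "eichler a d c *\<^sub>v unit_vec n 0 = unit_vec n 0 +
    (row_mult d \<phi> - c \<cdot>\<^sub>v row_mult a \<phi>) $ 0 \<cdot>\<^sub>v a + row_mult a \<phi> $ 0 \<cdot>\<^sub>v d"
  using assms n_pos eichler_carrier[OF assms, of c] \<phi>_carrier
  by (subst mult_unit_vec) (auto intro!: eq_vecI simp: eichler_def mult.commute
      carrier_vecD[OF row_mult_dim[OF \<phi>_carrier]])

lemma unit_row_\<phi>: "row_mult (unit_vec n 0) \<phi> $ 0 = 0"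
  using n_pos \<phi>_carrier by (simp add: row_mult_unit \<phi>_index(2))

lemma row_mult_\<psi>_\<phi>: "x \<in> carrier_vec n \<Longrightarrow> row_mult (row_mult x (gl_inv n \<phi>)) \<phi> = x"
  using \<phi>_carrier \<psi>_carrier by (simp add: row_mult_mult GL_l_inv[OF \<phi>_GL])

text \<open>\<open>b\<close> is the vector that pairs with all others as \<open>x\<close> does.
  Dropping its first entry gives \<open>d\<close>, and the parameter \<open>- b $ 0\<close>
  compensates, so the Eichler matrix becomes
  \<open>1\<^sub>m n + outer e x + outer d (row_mult e \<phi>)\<close>. Its first row is right
  because \<open>d $ 0 = 0\<close>, its first column because \<open>x $ 0 = 0\<close>, and
  \<open>d\<close> inherits from \<open>x\<close> membership of its entries in an ideal.\<close>

lemma symplectic_with_row: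
  assumes x: "x \<in> carrier_vec n" "x $ 0 = 0"
  shows "\<exists>s \<in> carrier_mat n n. s\<^sup>T * \<phi> * s = \<phi> \<and> row_mult (unit_vec n 0) s = unit_vec n 0 + x \<and>
    s *\<^sub>v unit_vec n 0 = unit_vec n 0 \<and>
    (\<forall>I. ring_ideal I \<longrightarrow> (\<forall>i<n. x $ i \<in> I) \<longrightarrow> mat_cong I s (1\<^sub>m n))"
proof -
  define e :: "'a vec" where "e = unit_vec n 0"
  define b where "b = row_mult x (gl_inv n \<phi>)"
  define d where "d = b - b $ 0 \<cdot>\<^sub>v e"
  have c: "e \<in> carrier_vec n" "b \<in> carrier_vec n" "d \<in> carrier_vec n"
    using \<psi>_carrier by (auto simp: e_def b_def d_def)
  have d0: "d $ 0 = 0" using c n_pos by (simp add: d_def e_def)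
  have b\<phi>: "row_mult b \<phi> = x" using x by (simp add: b_def row_mult_\<psi>_\<phi>)
  have d\<phi>: "row_mult d \<phi> = x - b $ 0 \<cdot>\<^sub>v row_mult e \<phi>"
  proof -
    have "row_mult d \<phi> = row_mult b \<phi> - b $ 0 \<cdot>\<^sub>v row_mult e \<phi>"
      using c \<phi>_carrier unfolding d_def row_mult_def
      by (simp add: mult_minus_distrib_mat_vec[of _ n n] mat_mult_smult_vec[of _ n n])
    then show ?thesis using b\<phi> by simp
  qed
  have \<beta>: "row_mult d \<phi> - (- b $ 0) \<cdot>\<^sub>v row_mult e \<phi> = x"
    unfolding d\<phi> using x \<phi>_carrier by (intro eq_vecI) (auto simp: carrier_vecD[OF row_mult_dim[OF \<phi>_carrier]])
  have e\<phi>0: "row_mult e \<phi> $ 0 = 0" by (simp add: e_def unit_row_\<phi>)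
  have eb: "row_mult e \<phi> \<bullet> d = 0"
  proof -
    have "row_mult e \<phi> \<bullet> b = e \<bullet> (\<phi> *\<^sub>v b)" using c \<phi>_carrier by (simp add: row_mult_scalar)
    also have "\<dots> = - x $ 0" using c x n_pos by (simp add: mult_vec_skew b\<phi> e_def)
    finally have "row_mult e \<phi> \<bullet> b = 0" using x by simp
    moreover have "row_mult e \<phi> \<bullet> e = 0" using c by (rule_tac isotropic)
    ultimately show ?thesis using c \<phi>_carrier
      by (simp add: d_def scalar_prod_minus_distrib[of _ n])
  qed
  let ?s = "eichler e d (- b $ 0)"
  show ?thesis
  proof (intro bexI conjI allI impI)
    show "?s \<in> carrier_mat n n" using c by simp
    show "?s\<^sup>T * \<phi> * ?s = \<phi>" using c eb by (rule_tac eichler_symplectic)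
    show "row_mult (unit_vec n 0) ?s = unit_vec n 0 + x"
      using c n_pos x \<phi>_carrier by (simp add: row_mult_eichler \<beta> d0) (auto simp: e_def intro!: eq_vecI
        simp: carrier_vecD[OF row_mult_dim[OF \<phi>_carrier]])
    show "?s *\<^sub>v unit_vec n 0 = unit_vec n 0"
      using c x n_pos by (simp add: eichler_mult_unit \<beta> e\<phi>0) (auto simp: e_def intro!: eq_vecI)
    fix I :: "'a set" assume I: "ring_ideal I" and xI: "\<forall>i<n. x $ i \<in> I"
    interpret ring_ideal I by fact
    have bI: "b $ i \<in> I" if "i < n" for i
      using x xI that \<psi>_carrier unfolding b_def
      by (auto simp: row_mult_index[of _ n _ n] intro!: I_sum I_rmult)
    then have dI: "d $ i \<in> I" if "i < n" for i
      using that c n_pos by (auto simp: d_def e_def I_zero intro!: I_diff I_rmult)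
    have "?s = 1\<^sub>m n + outer e x + outer d (row_mult e \<phi>)" by (simp add: eichler_def \<beta>)
    then show "mat_cong I ?s (1\<^sub>m n)"
      using c x dI xI \<phi>_carrier
      by (auto simp: mat_cong_def carrier_vecD[OF row_mult_dim[OF \<phi>_carrier]]
          intro!: I_add I_lmult[of "x $ _"] I_rmult[of "d $ _"])
  qed
qed

lemma symplectic_with_col:
  assumes x: "x \<in> carrier_vec n" "x $ 0 = 0"
  shows "\<exists>s \<in> carrier_mat n n. s\<^sup>T * \<phi> * s = \<phi> \<and> row_mult (unit_vec n 0) s = unit_vec n 0 \<and>
    s *\<^sub>v unit_vec n 0 = unit_vec n 0 + x"
proof -
  define e :: "'a vec" where "e = unit_vec n 0"
  define a where "a = row_mult e (gl_inv n \<phi>)"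
  have c: "e \<in> carrier_vec n" "a \<in> carrier_vec n"
    using \<psi>_carrier by (auto simp: e_def a_def)
  have a\<phi>: "row_mult a \<phi> = e" using c by (simp add: a_def row_mult_\<psi>_\<phi>)
  have a0: "a $ 0 = 0" using isotropic[OF c(2)] a\<phi> c n_pos by (simp add: e_def)
  have ax: "row_mult a \<phi> \<bullet> x = 0" using x n_pos by (simp add: a\<phi> e_def)
  \<comment> \<open>This parameter removes the multiple of \<open>a\<close> from the first
    column.\<close>
  define y where "y = row_mult x \<phi> $ 0"
  let ?s = "eichler a x y"
  show ?thesis
  proof (intro bexI conjI)
    show "?s \<in> carrier_mat n n" using c x by simp
    show "?s\<^sup>T * \<phi> * ?s = \<phi>" using c x ax by (rule_tac eichler_symplectic)
    show "row_mult (unit_vec n 0) ?s = unit_vec n 0"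
      using c x n_pos \<phi>_carrier by (simp add: row_mult_eichler a\<phi> a0)
       (auto simp: e_def carrier_vecD[OF row_mult_dim[OF \<phi>_carrier]] intro!: eq_vecI)
    show "?s *\<^sub>v unit_vec n 0 = unit_vec n 0 + x"
      using c x n_pos \<phi>_carrier by (simp add: eichler_mult_unit a\<phi> y_def)
       (auto simp: e_def carrier_vecD[OF row_mult_dim[OF \<phi>_carrier]] intro!: eq_vecI)
  qed
qed

end

lemma GL_inv_fixes_row:
  fixes s :: "'a::comm_ring_1 mat"
  assumes "s \<in> carrier (GL n)" "row_mult x s = y" "x \<in> carrier_vec n"
  shows "row_mult y (gl_inv n s) = x"
  using assms row_mult_mult[of x n s "gl_inv n s"] GL_carrier_mat[OF assms(1)]
    GL_inv_carrier_mat[OF assms(1)] by (simp add: GL_r_inv)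

lemma GL_inv_fixes_col:
  fixes s :: "'a::comm_ring_1 mat"
  assumes "s \<in> carrier (GL n)" "s *\<^sub>v x = y" "x \<in> carrier_vec n"
  shows "gl_inv n s *\<^sub>v y = x"
  using assms assoc_mult_mat_vec[of "gl_inv n s" n n s n x] GL_carrier_mat[OF assms(1)]
    GL_inv_carrier_mat[OF assms(1)] by (simp add: GL_l_inv)

section \<open>From linear to symplectic orbits\<close>

locale relative_form = ring_ideal I + alternating_form n \<phi>
  for I :: "'a::comm_ring_1 set" and n :: nat and \<phi> :: "'a mat" +
  assumes n_ge_3: "n \<ge> 3"
begin

abbreviation e1 :: "'a vec" where "e1 \<equiv> unit_vec n 0"

abbreviation orb :: "'a vec set" where "orb \<equiv> e1_orbit n (Sp_rel \<phi> I)"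

lemma orb_mult:
  assumes "u \<in> orb" "s \<in> Sp_rel \<phi> I"
  shows "row_mult u s \<in> orb"
proof -
  obtain t where t: "t \<in> Sp_rel \<phi> I" "u = row_mult e1 t"
    using assms by (auto simp: e1_orbit_def)
  note st = Sp_relD[OF assms(2) \<phi>_carrier] Sp_relD[OF t(1) \<phi>_carrier]
  note c = GL_relD(2)[OF st(1)] GL_relD(2)[OF st(3)]
  have "t * s \<in> Sp_rel \<phi> I"
    using st c \<phi>_carrier by (intro Sp_rel_I GL_rel_mult symplectic_mult) auto
  moreover have "row_mult u s = row_mult e1 (t * s)" using t c by (simp add: row_mult_mult[of _ n])
  ultimately show ?thesis by (auto simp: e1_orbit_def)
qed

text \<open>As \<open>s\<close> fixes the first unit row, e1 t s equals e1 (s^-1 t s), and the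
  conjugate is congruent to the identity although \<open>s\<close> need not be.\<close>

lemma orb_mult_fixing:
  assumes "u \<in> orb" "s \<in> carrier (GL n)" "s\<^sup>T * \<phi> * s = \<phi>" "row_mult e1 s = e1"
  shows "row_mult u s \<in> orb"
proof -
  obtain t where t: "t \<in> Sp_rel \<phi> I" "u = row_mult e1 t"
    using assms by (auto simp: e1_orbit_def)
  note st = Sp_relD[OF t(1) \<phi>_carrier]
  note c = GL_relD(2)[OF st(1)] GL_carrier_mat[OF assms(2)] GL_inv_carrier_mat[OF assms(2)]
  let ?r = "gl_inv n s * t * s"
  have "?r \<in> GL_rel n I"
    using st(1) c assms by (intro GL_rel_conj) (auto simp: GL_inv GL_l_inv)
  moreover have "(gl_inv n s)\<^sup>T * \<phi> * gl_inv n s = \<phi>"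
    using c \<phi>_carrier assms by (rule_tac symplectic_inverse[of s n]) (auto simp: GL_r_inv)
  then have "?r\<^sup>T * \<phi> * ?r = \<phi>"
    using symplectic_mult[of "gl_inv n s * t" n s \<phi>] symplectic_mult[of "gl_inv n s" n t \<phi>]
      st(2) c \<phi>_carrier assms(3) by (simp add: square_mult_closed)
  ultimately have "?r \<in> Sp_rel \<phi> I" using \<phi>_carrier by (intro Sp_rel_I)
  moreover have "row_mult e1 ?r = row_mult (row_mult (row_mult e1 (gl_inv n s)) t) s"
    using c by (simp add: row_mult_mult[of _ n] square_mult_closed)
  then have "row_mult u s = row_mult e1 ?r"
    using t assms GL_inv_fixes_row[OF assms(2,4)] by simp
  ultimately show ?thesis by (auto simp: e1_orbit_def)
qed

text \<open>The Levi subgroup common to the two parabolics: block sums of 1 with an invertible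
  matrix of size \<open>n - 1\<close>.\<close>

definition levi :: "'a mat set" where
  "levi = {h \<in> carrier (GL n). row_mult e1 h = e1 \<and> h *\<^sub>v e1 = e1}"

text \<open>The largest subset of \<open>orb\<close> stable under \<open>levi\<close>. Elements of
  \<open>levi\<close> need not preserve the form, so stability of \<open>orb\<close> itself is not
  known beforehand.\<close>

definition levi_core :: "'a vec set" where
  "levi_core = {u \<in> carrier_vec n. \<forall>h \<in> levi. row_mult u h \<in> orb}"

text \<open>
  A matrix with first column \<open>e\<^sub>1\<close>, or with first row \<open>e\<^sub>1\<close>, is the product of an element of
  \<open>levi\<close> and a symplectic one. This factorization survives right multiplication by \<open>levi\<close>,
  so both kinds of matrices preserve \<open>levi_core\<close>.
\<close>

lemma levi_core_col:
  assumes u: "u \<in> levi_core" and g: "g \<in> carrier (GL n)" "g *\<^sub>v e1 = e1"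
    and cong: "\<And>j. j < n \<Longrightarrow> row_mult e1 g $ j - e1 $ j \<in> I"
  shows "row_mult u g \<in> levi_core"
proof -
  have uc: "u \<in> carrier_vec n" using u by (simp add: levi_core_def)
  note gc = GL_carrier_mat[OF g(1)]
  have "row_mult (row_mult u g) h \<in> orb" if "h \<in> levi" for h
  proof -
    have h: "h \<in> carrier (GL n)" "row_mult e1 h = e1" "h *\<^sub>v e1 = e1"
      using that by (auto simp: levi_def)
    note hc = GL_carrier_mat[OF h(1)]
    define k where "k = g * h"
    have k: "k \<in> carrier (GL n)" "k *\<^sub>v e1 = e1"
      using g h gc hc by (simp_all add: k_def GL_mult assoc_mult_mat_vec[of g n n h n])
    note kc = GL_carrier_mat[OF k(1)]
    define x where "x = row_mult e1 k - e1"
    have xc: "x \<in> carrier_vec n" using kc by (simp add: x_def)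
    have "row_mult e1 k \<bullet> e1 = e1 \<bullet> (k *\<^sub>v e1)" using kc by (simp add: row_mult_scalar[of _ n])
    then have x0: "x $ 0 = 0" using kc k n_pos by (simp add: x_def)
    \<comment> \<open>Since \<open>h\<close> fixes the first unit row, \<open>x\<close> is the row
      \<open>row_mult e1 g - e1\<close>, with entries in \<open>I\<close>, multiplied by
      \<open>h\<close>.\<close>
    have xI: "x $ i \<in> I" if i: "i < n" for i
    proof -
      let ?y = "row_mult e1 g - e1"
      have y: "?y \<in> carrier_vec n" using gc by simp
      have "row_mult ?y h = row_mult (row_mult e1 g) h - row_mult e1 h"
        using hc gc unfolding row_mult_def[of _ h]
        by (simp add: mult_minus_distrib_mat_vec[of _ n n])
      also have "\<dots> = x" using gc hc h by (simp add: x_def k_def row_mult_mult[of _ n])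
      finally have "x $ i = (\<Sum>j<n. ?y $ j * h $$ (j, i))"
        using row_mult_index[OF y hc i] by simp
      also have "\<dots> \<in> I" using cong gc by (intro I_sum I_rmult) simp
      finally show ?thesis .
    qed
    obtain s where s: "s \<in> carrier_mat n n" "s\<^sup>T * \<phi> * s = \<phi>" "row_mult e1 s = e1 + x"
      "s *\<^sub>v e1 = e1" "mat_cong I s (1\<^sub>m n)"
      using symplectic_with_row[OF xc x0] xI ring_ideal_axioms by blast
    have sG: "s \<in> carrier (GL n)" using symplectic_GL s(1,2) \<phi>_GL by blast
    note sc = GL_inv_carrier_mat[OF sG]
    have sS: "s \<in> Sp_rel \<phi> I" using s sG \<phi>_carrier by (intro Sp_rel_I) (auto simp: GL_rel_def)
    have row: "row_mult e1 s = row_mult e1 k"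
      unfolding s(3) x_def using kc by (intro eq_vecI) (auto simp: carrier_vecD[OF row_mult_dim[OF kc]])
    let ?h = "k * gl_inv n s"
    have "row_mult e1 ?h = row_mult (row_mult e1 s) (gl_inv n s)"
      using kc sc by (simp add: row row_mult_mult[of _ n])
    also have "\<dots> = e1" using GL_inv_fixes_row[OF sG] by simp
    finally have "row_mult e1 ?h = e1" .
    moreover have "?h *\<^sub>v e1 = e1"
      using GL_inv_fixes_col[OF sG s(4)] k kc sc by (simp add: assoc_mult_mat_vec[of k n n _ n])
    ultimately have "?h \<in> levi" using k sG by (simp add: levi_def GL_mult GL_inv)
    then have "row_mult (row_mult u ?h) s \<in> orb"
      using u sS by (rule_tac orb_mult) (auto simp: levi_core_def)
    moreover have "?h * s = k" using kc sc s(1) GL_l_inv[OF sG] by (simp add: square_assoc[of _ n])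
    ultimately show ?thesis using uc kc sc s(1) gc hc
      by (simp add: row_mult_mult[of _ n] square_mult_closed k_def)
  qed
  then show ?thesis using gc by (simp add: levi_core_def)
qed

lemma levi_core_row:
  assumes u: "u \<in> levi_core" and g: "g \<in> carrier (GL n)" "row_mult e1 g = e1"
  shows "row_mult u g \<in> levi_core"
proof -
  have uc: "u \<in> carrier_vec n" using u by (simp add: levi_core_def)
  note gc = GL_carrier_mat[OF g(1)]
  have "row_mult (row_mult u g) h \<in> orb" if "h \<in> levi" for h
  proof -
    have h: "h \<in> carrier (GL n)" "row_mult e1 h = e1" using that by (auto simp: levi_def)
    note hc = GL_carrier_mat[OF h(1)]
    define k where "k = g * h"
    have k: "k \<in> carrier (GL n)" "row_mult e1 k = e1"
      using g h gc hc by (simp_all add: k_def GL_mult row_mult_mult[of _ n, symmetric])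
    note kc = GL_carrier_mat[OF k(1)] GL_inv_carrier_mat[OF k(1)]
    \<comment> \<open>The inverse is used so that the isometry \<open>s\<close> has the first column
      of \<open>gl_inv n k\<close> and \<open>k * s\<close> fixes that unit column. \<open>s\<close>
      may fail to be congruent to the identity, but it fixes the first unit row, so
      \<open>orb_mult_fixing\<close> can remove it again.\<close>
    define x where "x = gl_inv n k *\<^sub>v e1 - e1"
    have xc: "x \<in> carrier_vec n" using kc by (simp add: x_def)
    have "row_mult e1 (gl_inv n k) \<bullet> e1 = e1 \<bullet> (gl_inv n k *\<^sub>v e1)"
      using kc by (simp add: row_mult_scalar[of _ n])
    then have "e1 \<bullet> (gl_inv n k *\<^sub>v e1) = 1"
      using GL_inv_fixes_row[OF k] n_pos by simp
    then have x0: "x $ 0 = 0" using kc n_pos by (simp add: x_def)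
    obtain s where s: "s \<in> carrier_mat n n" "s\<^sup>T * \<phi> * s = \<phi>" "row_mult e1 s = e1" "s *\<^sub>v e1 = e1 + x"
      using symplectic_with_col[OF xc x0] by blast
    have sG: "s \<in> carrier (GL n)" using symplectic_GL s(1,2) \<phi>_GL by blast
    note sc = GL_inv_carrier_mat[OF sG]
    have col: "s *\<^sub>v e1 = gl_inv n k *\<^sub>v e1"
      unfolding s(4) x_def using kc by (intro eq_vecI) auto
    have "row_mult e1 (k * s) = e1" using k s kc by (simp add: row_mult_mult[of _ n, symmetric])
    moreover have "k * s *\<^sub>v e1 = (k * gl_inv n k) *\<^sub>v e1"
      using kc s(1) by (simp add: col assoc_mult_mat_vec[of k n n _ n])
    ultimately have "k * s \<in> levi" using k sG by (simp add: levi_def GL_mult GL_r_inv)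
    then have "row_mult u (k * s) \<in> orb" using u by (auto simp: levi_core_def)
    moreover have "(gl_inv n s)\<^sup>T * \<phi> * gl_inv n s = \<phi>"
      using s sc \<phi>_carrier GL_r_inv[OF sG] by (rule_tac symplectic_inverse[of s n])
    ultimately have "row_mult (row_mult u (k * s)) (gl_inv n s) \<in> orb"
      using sG GL_inv_fixes_row[OF sG s(3)] by (rule_tac orb_mult_fixing) (auto simp: GL_inv)
    moreover have "k * s * gl_inv n s = k" using kc sc s(1) GL_r_inv[OF sG] by (simp add: square_assoc[of _ n])
    ultimately show ?thesis using uc kc sc s(1) gc hc
      by (simp add: row_mult_mult[of _ n] square_mult_closed k_def)
  qed
  then show ?thesis using gc by (simp add: levi_core_def)
qed

theorem e1_E_rel_orbit: "e1_orbit n (E_rel n I) \<subseteq> orb"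
proof -
  \<comment> \<open>The stabilizer of \<open>levi_core\<close> is multiplicative and contains both
    parabolic parts, hence all of \<open>E_rel n I\<close>; the first unit row lies in
    \<open>levi_core\<close> because \<open>levi\<close> fixes it.\<close>
  let ?K = "{g \<in> carrier (GL n). \<forall>u \<in> levi_core. row_mult u g \<in> levi_core}"
  interpret parabolic_closed I n ?K
  proof
    show "n \<ge> 3" by (rule n_ge_3)
    show "A * B \<in> ?K" if "A \<in> ?K" "B \<in> ?K" for A B
    proof -
      have "row_mult u (A * B) \<in> levi_core" if "u \<in> levi_core" for u
      proof -
        have "row_mult (row_mult u A) B \<in> levi_core" "u \<in> carrier_vec n"
          using \<open>A \<in> ?K\<close> \<open>B \<in> ?K\<close> \<open>u \<in> levi_core\<close> by (auto simp: levi_core_def)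
        then show ?thesis
          using \<open>A \<in> ?K\<close> \<open>B \<in> ?K\<close> by (simp add: row_mult_mult[of _ n] GL_carrier_mat)
      qed
      then show ?thesis using that by (simp add: GL_mult)
    qed
  qed (use levi_core_col levi_core_row in auto)
  have one: "1\<^sub>m n \<in> Sp_rel \<phi> I"
    using \<phi>_carrier by (intro Sp_rel_I) (auto simp: GL_rel_one)
  have "e1 \<in> orb" using one by (force simp: e1_orbit_def)
  then have "e1 \<in> levi_core" by (simp add: levi_core_def levi_def)
  moreover have "levi_core \<subseteq> orb"
  proof
    fix u assume u: "u \<in> levi_core"
    have "1\<^sub>m n \<in> levi" by (simp add: levi_def GL_one)
    then have "row_mult u (1\<^sub>m n) \<in> orb" using u unfolding levi_core_def by blast
    then show "u \<in> orb" using u by (simp add: levi_core_def)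
  qed
  ultimately show ?thesis using E_rel_subset by (fastforce simp: e1_orbit_def[of n "E_rel n I"])
qed

end

section \<open>Block sums and stabilization\<close>

lemma block_sum_dim [simp]:
  "dim_row (A \<perp> B) = dim_row A + dim_row B" "dim_col (A \<perp> B) = dim_col A + dim_col B"
  by (simp_all add: block_sum_def)

lemma block_sum_carrier [simp]:
  "A \<in> carrier_mat m m' \<Longrightarrow> B \<in> carrier_mat n n' \<Longrightarrow> A \<perp> B \<in> carrier_mat (m + n) (m' + n')"
  by (simp add: block_sum_def)

lemma block_sum_eq:
  "A \<in> carrier_mat m m' \<Longrightarrow> B \<in> carrier_mat n n' \<Longrightarrow>
    A \<perp> B = four_block_mat A (0\<^sub>m m n') (0\<^sub>m n m') B"
  by (simp add: block_sum_def)

lemma block_sum_index: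
  assumes "A \<in> carrier_mat m m'" "B \<in> carrier_mat n n'" "i < m + n" "j < m' + n'"
  shows "(A \<perp> B) $$ (i, j) = (if i < m then if j < m' then A $$ (i, j) else 0
    else if j < m' then 0 else B $$ (i - m, j - m'))"
  using assms by (auto simp: block_sum_def)

lemma block_sum_assoc: "A \<perp> (B \<perp> C) = A \<perp> B \<perp> C"
  unfolding block_sum_def by (rule assoc_four_block_mat)

lemma block_sum_mult:
  fixes A A' B B' :: "'a::comm_ring_1 mat"
  assumes "A \<in> carrier_mat m m" "A' \<in> carrier_mat m m" "B \<in> carrier_mat n n" "B' \<in> carrier_mat n n"
  shows "(A \<perp> B) * (A' \<perp> B') = (A * A') \<perp> (B * B')"
  using assms
  by (simp add: block_sum_eq[of _ m m _ n n] mult_four_block_mat[of _ m m _ n _ n _ _ m _ n] square_mult_closed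
      left_add_zero_mat[of _ n n] right_add_zero_mat[of _ m m])

lemma block_sum_one: "1\<^sub>m m \<perp> 1\<^sub>m n = 1\<^sub>m (m + n)"
  by (simp add: block_sum_def)

lemma block_sum_transpose: "(A \<perp> B)\<^sup>T = A\<^sup>T \<perp> B\<^sup>T"
  by (intro eq_matI) (auto simp: block_sum_def)

lemma block_sum_GL:
  assumes "A \<in> carrier (GL m)" "B \<in> carrier (GL n)"
  shows "A \<perp> B \<in> carrier (GL (m + n))" "gl_inv (m + n) (A \<perp> B) = gl_inv m A \<perp> gl_inv n B"
proof -
  note c = assms[THEN GL_carrier_mat] assms[THEN GL_inv_carrier_mat]
  have "(A \<perp> B) * (gl_inv m A \<perp> gl_inv n B) = 1\<^sub>m (m + n)"
    "(gl_inv m A \<perp> gl_inv n B) * (A \<perp> B) = 1\<^sub>m (m + n)"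
    using c assms by (simp_all add: block_sum_mult[of _ m _ _ n] GL_l_inv GL_r_inv block_sum_one)
  moreover have "A \<perp> B \<in> carrier_mat (m + n) (m + n)" "gl_inv m A \<perp> gl_inv n B \<in> carrier_mat (m + n) (m + n)"
    using c by simp_all
  ultimately show "A \<perp> B \<in> carrier (GL (m + n))" "gl_inv (m + n) (A \<perp> B) = gl_inv m A \<perp> gl_inv n B"
    by (auto intro: GL_I GL_inv_eq)
qed

lemma (in ring_ideal) GL_rel_index:
  assumes "A \<in> GL_rel n I" "i < n" "j < n"
  shows "A $$ (i, j) - (if i = j then 1 else 0) \<in> I"
  using GL_relD(2,3)[OF assms(1)] assms(2,3) by (force simp: mat_cong_def)

lemma (in ring_ideal) block_sum_GL_rel:
  assumes "A \<in> GL_rel m I" "B \<in> GL_rel n I"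
  shows "A \<perp> B \<in> GL_rel (m + n) I"
proof -
  note A = GL_relD[OF assms(1)] and B = GL_relD[OF assms(2)]
  have "(A \<perp> B) $$ (i, j) - 1\<^sub>m (m + n) $$ (i, j) \<in> I" if "i < m + n" "j < m + n" for i j
  proof -
    have "i - m < n" if "\<not> i < m" using \<open>i < m + n\<close> that by simp
    moreover have "j - m < n" if "\<not> j < m" using \<open>j < m + n\<close> that by simp
    moreover have "i - m = j - m \<longleftrightarrow> i = j" if "\<not> i < m" "\<not> j < m" using that by auto
    ultimately show ?thesis
      using A(2) B(2) that GL_rel_index[OF assms(1), of i j] GL_rel_index[OF assms(2), of "i - m" "j - m"]
      by (auto simp: block_sum_index[of A m m B n n] I_zero split: if_splits)
  qed
  then show ?thesis using A B block_sum_GL by (simp add: GL_rel_def mat_cong_def)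
qed

lemma block_sum_symplectic:
  fixes A B \<phi> \<psi> :: "'a::comm_ring_1 mat"
  assumes "A \<in> carrier_mat m m" "B \<in> carrier_mat n n" "\<phi> \<in> carrier_mat m m" "\<psi> \<in> carrier_mat n n"
    "A\<^sup>T * \<phi> * A = \<phi>" "B\<^sup>T * \<psi> * B = \<psi>"
  shows "(A \<perp> B)\<^sup>T * (\<phi> \<perp> \<psi>) * (A \<perp> B) = \<phi> \<perp> \<psi>"
  using assms by (simp add: block_sum_transpose block_sum_mult[of _ m _ _ n] square_mult_closed)

lemma (in ring_ideal) block_sum_Sp_rel:
  assumes "A \<in> Sp_rel \<phi> I" "B \<in> Sp_rel \<psi> I" "\<phi> \<in> carrier_mat m m" "\<psi> \<in> carrier_mat n n"
  shows "A \<perp> B \<in> Sp_rel (\<phi> \<perp> \<psi>) I"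
proof -
  note A = Sp_relD[OF assms(1,3)] and B = Sp_relD[OF assms(2,4)]
  show ?thesis
    using A B GL_relD[OF A(1)] GL_relD[OF B(1)] assms
    by (intro Sp_rel_I[of _ "m + n"] block_sum_GL_rel block_sum_symplectic[of _ m _ n]) auto
qed

lemma (in ring_ideal) one_Sp_rel: "\<phi> \<in> carrier_mat n n \<Longrightarrow> 1\<^sub>m n \<in> Sp_rel \<phi> I"
  by (intro Sp_rel_I) (auto simp: GL_rel_one)

lemma stab_stab: "1\<^sub>m p \<perp> (1\<^sub>m q \<perp> A) = 1\<^sub>m (p + q) \<perp> A"
  by (simp add: block_sum_assoc block_sum_one)

lemma stab_zero: "1\<^sub>m 0 \<perp> A = A"
  by (intro eq_matI) (auto simp: block_sum_def)

lemma stab_mult: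
  fixes A B :: "'a::comm_ring_1 mat"
  assumes "A \<in> carrier_mat n n" "B \<in> carrier_mat n n"
  shows "1\<^sub>m p \<perp> (A * B) = (1\<^sub>m p \<perp> A) * (1\<^sub>m p \<perp> B)"
  using assms by (simp add: block_sum_mult[of _ p _ _ n])

lemma stab_funpow: "((\<lambda>\<alpha>. 1\<^sub>m q \<perp> \<alpha>) ^^ p) A = 1\<^sub>m (q * p) \<perp> A"
  by (induct p) (simp_all add: stab_zero stab_stab)

lemma det_stab:
  fixes A :: "'a::comm_ring_1 mat"
  assumes "A \<in> carrier_mat n n"
  shows "det (1\<^sub>m p \<perp> A) = det A"
  using assms
proof (induct p arbitrary: n A)
  case (Suc p)
  let ?B = "1\<^sub>m p \<perp> A"
  have B: "?B \<in> carrier_mat (p + n) (p + n)" using Suc by simp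
  let ?C = "1\<^sub>m 1 \<perp> ?B"
  have C: "?C \<in> carrier_mat (1 + (p + n)) (1 + (p + n))" by (intro block_sum_carrier B) simp
  have "det ?C = (\<Sum>j<1 + (p + n). ?C $$ (0, j) * cofactor ?C 0 j)"
    by (rule laplace_expansion_row[OF C]) simp
  also have "\<dots> = (\<Sum>j\<in>{0}. ?C $$ (0, j) * cofactor ?C 0 j)"
    using block_sum_index[OF one_carrier_mat B, of 0 1]
    by (intro sum.mono_neutral_right) auto
  also have "\<dots> = cofactor ?C 0 0"
    using block_sum_index[OF one_carrier_mat B, of 0 1 0] by simp
  also have "mat_delete ?C 0 0 = ?B"
    using B C Suc.prems block_sum_index[OF one_carrier_mat B, of "Suc _" 1 "Suc _"]
    by (intro eq_matI) (auto simp: mat_delete_def)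
  then have "cofactor ?C 0 0 = det ?B" by (simp add: cofactor_def)
  finally show ?case using Suc by (simp add: stab_stab)
qed (simp add: stab_zero)

lemma stab_elem_mat:
  "i < n \<Longrightarrow> j < n \<Longrightarrow> 1\<^sub>m p \<perp> elem_mat n i j a = elem_mat (p + n) (p + i) (p + j) a"
  by (intro eq_matI) (auto simp: block_sum_index[OF one_carrier_mat elem_mat_carrier] elem_mat_index)

lemma stab_E_abs: "A \<in> E_abs n \<Longrightarrow> 1\<^sub>m p \<perp> A \<in> E_abs (p + n)"
proof (induct rule: E_abs_induct)
  case (mult A B)
  then show ?case
    by (simp add: stab_mult[of _ n] GL_carrier_mat[OF E_abs_GL] E_abs_mult)
qed (simp_all add: block_sum_one E_abs_one stab_elem_mat elem_mat_E_abs)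

lemma (in ring_ideal) stab_E_rel: "A \<in> E_rel n I \<Longrightarrow> 1\<^sub>m p \<perp> A \<in> E_rel (p + n) I"
proof (induct rule: E_rel_induct)
  case (gen \<alpha> i j a)
  have g: "\<alpha> \<in> carrier (GL n)" using gen(1) by (rule E_abs_GL)
  note c = GL_carrier_mat[OF g] GL_inv_carrier_mat[OF g]
  have "1\<^sub>m p \<perp> gl_inv n \<alpha> = gl_inv (p + n) (1\<^sub>m p \<perp> \<alpha>)"
    using block_sum_GL(2)[OF GL_one[of p] g] GL_inv_eq[of "1\<^sub>m p :: 'a mat" p "1\<^sub>m p"] by simp
  then have "1\<^sub>m p \<perp> (\<alpha> * elem_mat n i j a * gl_inv n \<alpha>) =
      (1\<^sub>m p \<perp> \<alpha>) * elem_mat (p + n) (p + i) (p + j) a * gl_inv (p + n) (1\<^sub>m p \<perp> \<alpha>)"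
    using gen c by (simp add: stab_mult[of _ n] square_mult_closed stab_elem_mat)
  then show ?case using gen by (simp add: E_rel_gen stab_E_abs)
qed (simp_all add: block_sum_one E_rel_one stab_mult[of _ n] E_rel_carrier_mat E_rel_mult)

section \<open>Unipotent matrices and the relative Whitehead lemma\<close>

text \<open>All nonzero entries of \<open>Y\<close> lie in rows from \<open>S\<close> and columns
  outside \<open>S\<close>, so products of such entries never occur and
  \<open>1\<^sub>m N + Y\<close> is the product of one elementary matrix per entry. \<open>H\<close>
  and \<open>J\<close> stay open to serve the relative group with the ideal and the absolute one
  with \<open>UNIV\<close>.\<close>

lemma unipotent_mem:
  fixes Y :: "'a::comm_ring_1 mat"
  assumes one: "1\<^sub>m N \<in> H" and mult: "\<And>A B. A \<in> H \<Longrightarrow> B \<in> H \<Longrightarrow> A * B \<in> H"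
    and elem: "\<And>i j a. i < N \<Longrightarrow> j < N \<Longrightarrow> i \<noteq> j \<Longrightarrow> a \<in> J \<Longrightarrow> elem_mat N i j a \<in> H"
    and Y: "Y \<in> carrier_mat N N"
    and supp: "\<And>i j. i < N \<Longrightarrow> j < N \<Longrightarrow> Y $$ (i, j) \<noteq> 0 \<Longrightarrow> i \<in> S \<and> j \<notin> S \<and> Y $$ (i, j) \<in> J"
  shows "1\<^sub>m N + Y \<in> H"
proof -
  define X where "X T = mat N N (\<lambda>p. if p \<in> T then Y $$ p else 0)" for T
  have X: "X T \<in> carrier_mat N N" for T by (simp add: X_def)
  let ?P = "{p \<in> {..<N} \<times> {..<N}. Y $$ p \<noteq> 0}"
  have fin: "finite ?P" by simp
  have "1\<^sub>m N + X T \<in> H" if "finite T" "T \<subseteq> ?P" for T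
    using that
  proof (induct T rule: finite_induct)
    case empty
    have "1\<^sub>m N + X {} = 1\<^sub>m N" by (intro eq_matI) (auto simp: X_def)
    then show ?case using one by simp
  next
    case (insert p T)
    obtain i j where p: "p = (i, j)" by force
    have ij: "i < N" "j < N" "i \<in> S" "j \<notin> S" "Y $$ (i, j) \<in> J"
      using insert(4) supp p by auto
    then have neq: "i \<noteq> j" by auto
    let ?y = "Y $$ (i, j)"
    \<comment> \<open>The index \<open>i\<close> is in \<open>S\<close>, hence is not a column of
      the support.\<close>
    have "X T *\<^sub>v (?y \<cdot>\<^sub>v unit_vec N i) = 0\<^sub>v N"
    proof -
      have "X T $$ (k, i) = 0" if "k < N" for k
        using insert(4) supp ij that by (force simp: X_def)
      then have "X T *\<^sub>v unit_vec N i = 0\<^sub>v N"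
        using ij X[of T] by (simp add: mult_unit_vec) (auto intro!: eq_vecI)
      then show ?thesis using X[of T] by (auto simp: mat_mult_smult_vec intro!: eq_vecI)
    qed
    then have "(1\<^sub>m N + X T) * elem_mat N i j ?y = 1\<^sub>m N + X T + outer (?y \<cdot>\<^sub>v unit_vec N i) (unit_vec N j)"
      using ij X[of T]
      by (simp add: elem_mat_eq_transv mat_mult_transv add_mult_distrib_mat_vec[of _ N N])
    also have "\<dots> = 1\<^sub>m N + X (insert p T)"
      using ij insert(2) p by (intro eq_matI) (auto simp: X_def)
    finally show ?case using mult[OF _ elem[OF ij(1,2) neq ij(5)]] insert by force
  qed
  from this[OF fin] have "1\<^sub>m N + X ?P \<in> H" by simp
  moreover have "X ?P = Y" using Y by (intro eq_matI) (auto simp: X_def)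
  ultimately show ?thesis by simp
qed

lemma unipotent_E_rel:
  assumes "Y \<in> carrier_mat N N"
    and "\<And>i j. i < N \<Longrightarrow> j < N \<Longrightarrow> Y $$ (i, j) \<noteq> 0 \<Longrightarrow> i \<in> S \<and> j \<notin> S \<and> Y $$ (i, j) \<in> I"
  shows "1\<^sub>m N + Y \<in> E_rel N I"
  by (rule unipotent_mem[where J = I and S = S]) (use assms in \<open>auto intro: E_rel_one E_rel_mult elem_mat_E_rel\<close>)

lemma unipotent_E_abs:
  assumes "Y \<in> carrier_mat N N"
    and "\<And>i j. i < N \<Longrightarrow> j < N \<Longrightarrow> Y $$ (i, j) \<noteq> 0 \<Longrightarrow> i \<in> S \<and> j \<notin> S"
  shows "1\<^sub>m N + Y \<in> E_abs N"
  by (rule unipotent_mem[where J = UNIV and S = S]) (use assms in \<open>auto intro: E_abs_one E_abs_mult elem_mat_E_abs\<close>)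

lemma lower_block_E_abs:
  assumes "Z \<in> carrier_mat q p"
  shows "four_block_mat (1\<^sub>m p) (0\<^sub>m p q) Z (1\<^sub>m q) \<in> E_abs (p + q)"
proof -
  have "four_block_mat (1\<^sub>m p) (0\<^sub>m p q) Z (1\<^sub>m q) =
      1\<^sub>m (p + q) + four_block_mat (0\<^sub>m p p) (0\<^sub>m p q) Z (0\<^sub>m q q)"
    using assms by (intro eq_matI) auto
  also have "\<dots> \<in> E_abs (p + q)"
    by (rule unipotent_E_abs[where S = "{p..}"]) (use assms in \<open>auto split: if_splits\<close>)
  finally show ?thesis .
qed

context ring_ideal
begin

lemma upper_block_E_rel:
  assumes "Y \<in> carrier_mat p q" "\<And>i j. i < p \<Longrightarrow> j < q \<Longrightarrow> Y $$ (i, j) \<in> I"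
  shows "four_block_mat (1\<^sub>m p) Y (0\<^sub>m q p) (1\<^sub>m q) \<in> E_rel (p + q) I"
proof -
  have "four_block_mat (1\<^sub>m p) Y (0\<^sub>m q p) (1\<^sub>m q) =
      1\<^sub>m (p + q) + four_block_mat (0\<^sub>m p p) Y (0\<^sub>m q p) (0\<^sub>m q q)"
    using assms by (intro eq_matI) auto
  also have "\<dots> \<in> E_rel (p + q) I"
    by (rule unipotent_E_rel[where S = "{..<p}"]) (use assms in \<open>auto split: if_splits\<close>)
  finally show ?thesis .
qed

lemma lower_block_E_rel:
  assumes "Z \<in> carrier_mat q p" "\<And>i j. i < q \<Longrightarrow> j < p \<Longrightarrow> Z $$ (i, j) \<in> I"
  shows "four_block_mat (1\<^sub>m p) (0\<^sub>m p q) Z (1\<^sub>m q) \<in> E_rel (p + q) I"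
proof -
  have "four_block_mat (1\<^sub>m p) (0\<^sub>m p q) Z (1\<^sub>m q) =
      1\<^sub>m (p + q) + four_block_mat (0\<^sub>m p p) (0\<^sub>m p q) Z (0\<^sub>m q q)"
    using assms by (intro eq_matI) auto
  also have "\<dots> \<in> E_rel (p + q) I"
    by (rule unipotent_E_rel[where S = "{p..}"]) (use assms in \<open>auto split: if_splits\<close>)
  finally show ?thesis .
qed

text \<open>The classical factorization has blocks outside \<open>I\<close>. Here it is regrouped
  with \<open>B - 1\<^sub>m p\<close>, \<open>1\<^sub>m p - A\<close> and
  \<open>1\<^sub>m p - B\<close> as blocks: the outer two factors are relative unipotents, and the
  middle one is a relative unipotent conjugated by the absolute matrix
  \<open>?V (1\<^sub>m p)\<close>.\<close>

lemma whitehead: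
  assumes "A \<in> GL_rel p I"
  shows "A \<perp> gl_inv p A \<in> E_rel (p + p) I"
proof -
  define B where "B = gl_inv p A"
  note A = GL_relD[OF assms]
  have Bg: "B \<in> GL_rel p I" unfolding B_def using assms by (rule GL_rel_inv)
  note B = GL_relD[OF Bg]
  have AB: "A * B = 1\<^sub>m p" "B * A = 1\<^sub>m p" using A(1) by (simp_all add: B_def GL_l_inv GL_r_inv)
  let ?U = "\<lambda>Y :: 'a mat. four_block_mat (1\<^sub>m p) Y (0\<^sub>m p p) (1\<^sub>m p)"
  let ?V = "\<lambda>Z :: 'a mat. four_block_mat (1\<^sub>m p) (0\<^sub>m p p) Z (1\<^sub>m p)"
  have U_I: "?U (1\<^sub>m p - C) \<in> E_rel (p + p) I" if "C \<in> GL_rel p I" for C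
  proof (rule upper_block_E_rel)
    note C = GL_relD[OF that]
    show "1\<^sub>m p - C \<in> carrier_mat p p" using C(2) by (rule minus_carrier_mat)
    show "(1\<^sub>m p - C) $$ (i, j) \<in> I" if "i < p" "j < p" for i j
      using mat_cong_sym[OF C(3)] C(2) that by (simp add: mat_cong_def)
  qed
  have V_I: "?V (B - 1\<^sub>m p) \<in> E_rel (p + p) I"
    using B by (intro lower_block_E_rel) (auto simp: mat_cong_def)
  have VV: "?V Y * ?V Z = ?V (Y + Z)" if "Y \<in> carrier_mat p p" "Z \<in> carrier_mat p p" for Y Z :: "'a mat"
    using that by (subst mult_four_block_mat[of _ p p _ p _ p _ _ p _ p]) auto
  have V0: "?V (0\<^sub>m p p) = 1\<^sub>m (p + p)" by simp
  have V1: "gl_inv (p + p) (?V (1\<^sub>m p)) = ?V (- 1\<^sub>m p)"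
  proof (rule GL_inv_eq)
    have z: "1\<^sub>m p + - 1\<^sub>m p = (0\<^sub>m p p :: 'a mat)" "- 1\<^sub>m p + 1\<^sub>m p = (0\<^sub>m p p :: 'a mat)"
      by (auto intro!: eq_matI)
    have "?V (1\<^sub>m p) * ?V (- 1\<^sub>m p) = ?V (1\<^sub>m p + - 1\<^sub>m p)" by (rule VV) simp_all
    then show "?V (1\<^sub>m p) * ?V (- 1\<^sub>m p) = 1\<^sub>m (p + p)" by (simp only: z V0)
    have "?V (- 1\<^sub>m p) * ?V (1\<^sub>m p) = ?V (- 1\<^sub>m p + 1\<^sub>m p)" by (rule VV) simp_all
    then show "?V (- 1\<^sub>m p) * ?V (1\<^sub>m p) = 1\<^sub>m (p + p)" by (simp only: z V0)
  qed simp_all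
  have "?V (1\<^sub>m p) * ?U (1\<^sub>m p - A) * gl_inv (p + p) (?V (1\<^sub>m p)) \<in> E_rel (p + p) I"
    by (intro E_rel_conj U_I assms lower_block_E_abs) simp
  then have mem: "?V (B - 1\<^sub>m p) * (?V (1\<^sub>m p) * ?U (1\<^sub>m p - A) * ?V (- 1\<^sub>m p)) * ?U (1\<^sub>m p - B) \<in> E_rel (p + p) I"
    using V_I U_I[OF Bg] by (simp add: V1 E_rel_mult)
  \<comment> \<open>For the evaluation the conjugate is taken apart: its right factor joins
    \<open>?U (1\<^sub>m p - B)\<close>, its left factor joins
    \<open>?V (B - 1\<^sub>m p)\<close>.\<close>
  have "?V (- 1\<^sub>m p) * ?U (1\<^sub>m p - B) = four_block_mat (1\<^sub>m p) (1\<^sub>m p - B) (- 1\<^sub>m p) B"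
    using B(2) by (subst mult_four_block_mat[of _ p p _ p _ p _ _ p _ p]) (auto intro!: cong_four_block_mat eq_matI)
  moreover have "?U (1\<^sub>m p - A) * four_block_mat (1\<^sub>m p) (1\<^sub>m p - B) (- 1\<^sub>m p) B =
      four_block_mat A (0\<^sub>m p p) (- 1\<^sub>m p) B"
    using A(2) B(2) AB
    by (subst mult_four_block_mat[of _ p p _ p _ p _ _ p _ p])
      (auto intro!: cong_four_block_mat eq_matI simp: minus_mult_distrib_mat[of _ p p _ _ p])
  moreover have "?V B * four_block_mat A (0\<^sub>m p p) (- 1\<^sub>m p) B = four_block_mat A (0\<^sub>m p p) (0\<^sub>m p p) B"
    using A(2) B(2) AB
    by (subst mult_four_block_mat[of _ p p _ p _ p _ _ p _ p])
      (auto intro!: cong_four_block_mat eq_matI)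
  moreover have "?V (B - 1\<^sub>m p) * ?V (1\<^sub>m p) = ?V B"
    using B(2) by (subst VV) (auto intro!: cong_four_block_mat eq_matI)
  moreover have "?V (B - 1\<^sub>m p) * (?V (1\<^sub>m p) * ?U (1\<^sub>m p - A) * ?V (- 1\<^sub>m p)) * ?U (1\<^sub>m p - B) =
    (?V (B - 1\<^sub>m p) * ?V (1\<^sub>m p)) * (?U (1\<^sub>m p - A) * (?V (- 1\<^sub>m p) * ?U (1\<^sub>m p - B)))"
    using A(2) B(2) by (simp add: square_simps[where n = "p + p"])
  ultimately have "four_block_mat A (0\<^sub>m p p) (0\<^sub>m p p) B \<in> E_rel (p + p) I" using mem by simp
  then show ?thesis using A(2) B(2) by (simp add: block_sum_eq[of A p p _ p p] B_def[symmetric])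
qed

end

section \<open>Splitting off hyperbolic planes\<close>

lemma chi1_carrier [simp]: "chi1 \<in> carrier_mat 2 2"
  by (simp add: chi1_def mat_of_rows_list_def numeral_2_eq_2)

lemma chi1_index: "chi1 $$ (0, 0) = 0" "chi1 $$ (0, Suc 0) = 1" "chi1 $$ (Suc 0, 0) = - 1"
    "chi1 $$ (Suc 0, Suc 0) = 0"
  by (simp_all add: chi1_def mat_of_rows_list_def)

lemma sum_two: "(\<Sum>i = 0..<2. f i) = f 0 + f (Suc 0 :: nat)"
  by (simp add: numeral_2_eq_2)

lemma chi1_GL: "(chi1 :: 'a::comm_ring_1 mat) \<in> carrier (GL 2)"
proof (rule GL_I)
  let ?B = "mat_of_rows_list 2 [[0, -1], [1, 0]] :: 'a mat"
  show "?B \<in> carrier_mat 2 2" by (simp add: mat_of_rows_list_def numeral_2_eq_2)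
  show "chi1 * ?B = 1\<^sub>m 2" "?B * chi1 = 1\<^sub>m 2"
    by (intro eq_matI; auto simp: chi1_def mat_of_rows_list_def scalar_prod_def sum_two less_2_cases_iff)+
qed simp

lemma chi_carrier [simp]: "chi n \<in> carrier_mat (2 * n) (2 * n)"
  by (induct n) (auto intro: block_sum_carrier[of _ "2 * n" "2 * n" chi1 2 2 for n, simplified])

lemma chi_0_sum: "chi 0 \<perp> A = A"
  by (intro eq_matI) (auto simp: block_sum_def)

lemma chi_add: "chi (m + n) = chi m \<perp> chi n"
proof (induct n)
  case 0
  show ?case by (intro eq_matI) (auto simp: block_sum_def)
qed (simp add: block_sum_assoc)

lemma chi_1: "chi (Suc 0) = chi1"
  by (simp add: chi_0_sum del: chi.simps(1))

text \<open>The recursion adds a plane on the right, while stabilization acts on the left; the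
  planes are therefore split off from the left.\<close>

lemma chi_Suc_left: "chi (Suc n) = chi1 \<perp> chi n"
  using chi_add[of "Suc 0" n] unfolding chi_1 by (simp only: plus_nat.add_Suc plus_nat.add_0)

lemma chi_GL: "(chi n :: 'a::comm_ring_1 mat) \<in> carrier (GL (2 * n))"
proof (induct n)
  case 0
  have "(0\<^sub>m 0 0 :: 'a mat) = 1\<^sub>m 0" by (intro eq_matI) auto
  then show ?case by (simp add: GL_one)
next
  case (Suc n)
  show ?case using block_sum_GL(1)[OF Suc chi1_GL] by (simp add: add.commute)
qed

lemma four_block_lower_right_eq:
  assumes "four_block_mat P Q R S = four_block_mat P' Q' R' S'"
    "P \<in> carrier_mat m m" "P' \<in> carrier_mat m m" "S \<in> carrier_mat k k" "S' \<in> carrier_mat k k"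
  shows "S = S'"
proof (rule eq_matI)
  fix i j assume "i < dim_row S'" "j < dim_col S'"
  then have ij: "i < k" "j < k" using assms by auto
  have "four_block_mat P Q R S $$ (m + i, m + j) = four_block_mat P' Q' R' S' $$ (m + i, m + j)"
    using assms(1) by simp
  then show "S $$ (i, j) = S' $$ (i, j)" using ij assms(2-5) by simp
qed (use assms in auto)

context ring_ideal
begin

lemma row_in_Um:
  assumes A: "A \<in> GL_rel N I" and N: "N > 0"
  shows "row_mult (unit_vec N 0) A \<in> Um N I"
proof -
  note c = GL_relD[OF A]
  note ic = GL_inv_carrier_mat[OF c(1)]
  have "row_mult (unit_vec N 0) A \<bullet> (gl_inv N A *\<^sub>v unit_vec N 0) =
      unit_vec N 0 \<bullet> ((A * gl_inv N A) *\<^sub>v unit_vec N 0)"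
    using c ic by (simp add: row_mult_scalar[of _ N] assoc_mult_mat_vec[of A N N _ N])
  also have "\<dots> = 1" using N by (simp add: GL_r_inv[OF c(1)])
  finally have "\<exists>w \<in> carrier_vec N. row_mult (unit_vec N 0) A \<bullet> w = 1"
    using ic by (metis mult_mat_vec_carrier unit_vec_carrier)
  moreover have "row_mult (unit_vec N 0) A $ i - unit_vec N 0 $ i \<in> I" if "i < N" for i
    using GL_rel_index[OF A N that] c(2) N that by (auto simp: row_mult_unit split: if_splits)
  ultimately show ?thesis using c(2) by (simp add: Um_def)
qed

text \<open>An isometry with first row \<open>?e\<close> also has second column \<open>?f\<close>.
  Apart from the block \<open>D\<close> only the first column and the second row then carry free
  entries, and these form two relative unipotents.\<close>

lemma symplectic_split_plane:
  assumes \<tau>: "\<tau> \<in> carrier (GL k)" and C: "C \<in> Sp_rel (chi1 \<perp> \<tau>) I"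
    and row: "row_mult (unit_vec (2 + k) 0) C = unit_vec (2 + k) 0"
  shows "\<exists>D \<in> Sp_rel \<tau> I. \<exists>G \<in> E_rel (2 + k) I. C = G * (1\<^sub>m 2 \<perp> D)"
proof -
  let ?N = "2 + k" and ?\<Phi> = "chi1 \<perp> \<tau>"
  let ?e = "unit_vec (2 + k) 0 :: 'a vec" and ?f = "unit_vec (2 + k) 1 :: 'a vec"
  note \<tau>c = GL_carrier_mat[OF \<tau>]
  have \<Phi>: "?\<Phi> \<in> carrier (GL ?N)" by (rule block_sum_GL(1)[OF chi1_GL \<tau>])
  note \<Phi>c = GL_carrier_mat[OF \<Phi>]
  note CS = Sp_relD[OF C \<Phi>c]
  note Cc = GL_relD[OF CS(1)]
  have row0: "C $$ (0, j) = (if j = 0 then 1 else 0)" if "j < ?N" for j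
    using arg_cong[OF row, of "\<lambda>v. v $ j"] that Cc(2) by (simp add: row_mult_unit)
  \<comment> \<open>The form sends \<open>?f\<close> to \<open>?e\<close>, and the transpose of
    \<open>C\<close> fixes \<open>?e\<close>. So the isometry equation applied to \<open>?f\<close>
    lets first the transpose and then the form be cancelled.\<close>
  have Cf: "C *\<^sub>v ?f = ?f"
  proof -
    have \<Phi>f: "?\<Phi> *\<^sub>v ?f = ?e"
    proof -
      have "?\<Phi> $$ (i, 1) = (if i = 0 then 1 else 0)" if "i < ?N" for i
        using block_sum_index[OF chi1_carrier \<tau>c that, of 1]
        by (auto simp: chi1_index less_2_cases_iff)
      then show ?thesis using \<Phi>c \<tau>c carrier_matD[OF chi1_carrier]
        by (intro eq_vecI) (auto simp: mult_unit_vec)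
    qed
    have inj: "x = y" if "A \<in> carrier (GL ?N)" "A *\<^sub>v x = A *\<^sub>v y" "x \<in> carrier_vec ?N" "y \<in> carrier_vec ?N"
      for A and x y :: "'a vec"
    proof -
      have "(gl_inv ?N A * A) *\<^sub>v x = (gl_inv ?N A * A) *\<^sub>v y"
        using that GL_carrier_mat[OF that(1)] GL_inv_carrier_mat[OF that(1)]
        by (simp only: assoc_mult_mat_vec[of _ ?N ?N _ ?N])
      then show ?thesis using that by (simp add: GL_l_inv)
    qed
    have CT: "C\<^sup>T \<in> carrier (GL ?N)"
    proof (rule GL_I[of _ _ "(gl_inv ?N C)\<^sup>T"])
      note ic = GL_inv_carrier_mat[OF Cc(1)]
      show "C\<^sup>T * (gl_inv ?N C)\<^sup>T = 1\<^sub>m ?N"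
        using transpose_mult[OF ic Cc(2)] GL_l_inv[OF Cc(1)] by simp
      show "(gl_inv ?N C)\<^sup>T * C\<^sup>T = 1\<^sub>m ?N"
        using transpose_mult[OF Cc(2) ic] GL_r_inv[OF Cc(1)] by simp
    qed (use Cc GL_inv_carrier_mat[OF Cc(1)] in auto)
    have "C\<^sup>T *\<^sub>v (?\<Phi> *\<^sub>v (C *\<^sub>v ?f)) = (C\<^sup>T * ?\<Phi> * C) *\<^sub>v ?f"
      using Cc(2) \<Phi>c by (simp add: assoc_mult_mat_vec[of _ ?N ?N _ ?N] square_mult_closed)
    also have "\<dots> = ?e" by (simp only: CS(2) \<Phi>f)
    also have "\<dots> = C\<^sup>T *\<^sub>v ?e" using row by (simp add: row_mult_def)
    finally have "?\<Phi> *\<^sub>v (C *\<^sub>v ?f) = ?e"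
      by (rule inj[OF CT]) (use Cc(2) \<Phi>c in \<open>auto intro!: mult_mat_vec_carrier[of _ ?N ?N]\<close>)
    then have "?\<Phi> *\<^sub>v (C *\<^sub>v ?f) = ?\<Phi> *\<^sub>v ?f" using \<Phi>f by simp
    then show ?thesis
      by (rule inj[OF \<Phi>]) (use Cc(2) in \<open>auto intro!: mult_mat_vec_carrier[of _ ?N ?N]\<close>)
  qed
  have col1: "C $$ (i, Suc 0) = (if i = 1 then 1 else 0)" if "i < ?N" for i
    using arg_cong[OF Cf, of "\<lambda>v. v $ i"] that Cc(2) by (simp add: mult_unit_vec)
  define A where "A = mat 2 2 (\<lambda>(i, j). C $$ (i, j))"
  define B where "B = mat 2 k (\<lambda>(i, j). C $$ (i, j + 2))"
  define Z where "Z = mat k 2 (\<lambda>(i, j). C $$ (i + 2, j))"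
  define D where "D = mat k k (\<lambda>(i, j). C $$ (i + 2, j + 2))"
  have bc: "A \<in> carrier_mat 2 2" "B \<in> carrier_mat 2 k" "Z \<in> carrier_mat k 2" "D \<in> carrier_mat k k"
    by (simp_all add: A_def B_def Z_def D_def)
  have shift: "\<not> i < 2 \<Longrightarrow> Suc (Suc (i - 2)) = i" for i by simp
  have Cb: "C = four_block_mat A B Z D"
    using Cc(2) by (intro eq_matI) (auto simp: A_def B_def Z_def D_def shift)
  have CT: "C\<^sup>T = four_block_mat A\<^sup>T Z\<^sup>T B\<^sup>T D\<^sup>T"
    unfolding Cb by (rule transpose_four_block_mat[OF bc])
  have "C\<^sup>T * ?\<Phi> = four_block_mat (A\<^sup>T * chi1) (Z\<^sup>T * \<tau>) (B\<^sup>T * chi1) (D\<^sup>T * \<tau>)"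
    unfolding CT block_sum_eq[OF chi1_carrier \<tau>c] using bc \<tau>c
    by (subst mult_four_block_mat[of _ 2 2 _ k _ k _ _ 2 _ k])
      (auto intro!: cong_four_block_mat simp: left_add_zero_mat[of _ _ k] right_add_zero_mat[of _ _ 2])
  then have "C\<^sup>T * ?\<Phi> * C = four_block_mat (A\<^sup>T * chi1) (Z\<^sup>T * \<tau>) (B\<^sup>T * chi1) (D\<^sup>T * \<tau>)
      * four_block_mat A B Z D"
    by (simp add: Cb)
  also have "\<dots> = four_block_mat (A\<^sup>T * chi1 * A + Z\<^sup>T * \<tau> * Z) (A\<^sup>T * chi1 * B + Z\<^sup>T * \<tau> * D)
      (B\<^sup>T * chi1 * A + D\<^sup>T * \<tau> * Z) (B\<^sup>T * chi1 * B + D\<^sup>T * \<tau> * D)"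
    using bc \<tau>c by (intro mult_four_block_mat[of _ 2 2 _ k _ k _ _ 2 _ k]) auto
  finally have "four_block_mat (A\<^sup>T * chi1 * A + Z\<^sup>T * \<tau> * Z) (A\<^sup>T * chi1 * B + Z\<^sup>T * \<tau> * D)
      (B\<^sup>T * chi1 * A + D\<^sup>T * \<tau> * Z) (B\<^sup>T * chi1 * B + D\<^sup>T * \<tau> * D) =
      four_block_mat chi1 (0\<^sub>m 2 k) (0\<^sub>m k 2) \<tau>"
    using CS(2) block_sum_eq[OF chi1_carrier \<tau>c] by simp
  then have "B\<^sup>T * chi1 * B + D\<^sup>T * \<tau> * D = \<tau>"
    by (rule four_block_lower_right_eq[where m = 2 and k = k])
      (use bc \<tau>c in \<open>auto intro!: mult_carrier_mat[of _ _ k] mult_carrier_mat[of _ _ 2] add_carrier_mat\<close>)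
  \<comment> \<open>Every term contains an entry of the first row of \<open>B\<close>, which is
    zero.\<close>
  moreover have "B\<^sup>T * chi1 * B = 0\<^sub>m k k"
  proof (rule eq_matI)
    fix i j assume ij: "i < dim_row (0\<^sub>m k k :: 'a mat)" "j < dim_col (0\<^sub>m k k :: 'a mat)"
    have "B $$ (0, l) = 0" if "l < k" for l using row0[of "l + 2"] that by (simp add: B_def)
    then show "(B\<^sup>T * chi1 * B) $$ (i, j) = 0\<^sub>m k k $$ (i, j)"
      using bc ij by (simp add: scalar_prod_def sum_two chi1_index carrier_matD[OF chi1_carrier])
  qed (use bc in auto)
  moreover have "D\<^sup>T * \<tau> * D \<in> carrier_mat k k" using bc \<tau>c by (simp add: square_mult_closed)
  ultimately have D\<tau>: "D\<^sup>T * \<tau> * D = \<tau>" by (simp add: left_add_zero_mat)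
  have DG: "D \<in> carrier (GL k)" by (rule symplectic_GL[OF bc(4) \<tau> D\<tau>])
  note D'c = GL_inv_carrier_mat[OF DG]
  have "D $$ (i, j) - 1\<^sub>m k $$ (i, j) \<in> I" if "i < k" "j < k" for i j
    using GL_rel_index[OF CS(1), of "i + 2" "j + 2"] that by (simp add: D_def)
  then have DR: "D \<in> GL_rel k I" using bc DG by (simp add: GL_rel_def mat_cong_def)
  have DS: "D \<in> Sp_rel \<tau> I" by (rule Sp_rel_I[OF DR \<tau>c D\<tau>])
  define G where "G = C * (1\<^sub>m 2 \<perp> gl_inv k D)"
  have GR: "G \<in> GL_rel ?N I"
    unfolding G_def by (intro GL_rel_mult CS(1) block_sum_GL_rel GL_rel_one GL_rel_inv DR)
  note Gc = GL_relD[OF GR]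
  have "G * (1\<^sub>m 2 \<perp> D) = C * ((1\<^sub>m 2 \<perp> gl_inv k D) * (1\<^sub>m 2 \<perp> D))"
    unfolding G_def using Cc(2) bc D'c by (intro square_assoc) auto
  also have "(1\<^sub>m 2 \<perp> gl_inv k D) * (1\<^sub>m 2 \<perp> D) = 1\<^sub>m ?N"
    using bc D'c by (simp add: stab_mult[of _ k, symmetric] GL_l_inv[OF DG] block_sum_one)
  finally have CG: "C = G * (1\<^sub>m 2 \<perp> D)" using Cc(2) by simp
  have Gb: "G = four_block_mat A (B * gl_inv k D) Z (1\<^sub>m k)"
    unfolding G_def Cb block_sum_eq[OF one_carrier_mat D'c] using bc D'c GL_r_inv[OF DG]
    by (subst mult_four_block_mat[of _ 2 2 _ k _ k _ _ 2 _ k])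
      (auto intro!: cong_four_block_mat simp: left_add_zero_mat[of _ _ k] right_add_zero_mat[of _ _ 2]
        mult_carrier_mat[of _ _ k])
  \<comment> \<open>After division by \<open>D\<close>, the first column below the diagonal and the
    second row to the right of the plane are all that distinguishes \<open>G\<close> from the
    identity.\<close>
  define y where "y = vec ?N (\<lambda>i. if i = 0 then 0 else G $$ (i, 0))"
  define z where "z = vec ?N (\<lambda>j. if j < 2 then 0 else G $$ (1, j))"
  have yz: "y \<in> carrier_vec ?N" "z \<in> carrier_vec ?N" by (simp_all add: y_def z_def)
  have "G = transv ?N y ?e * transv ?N ?f z"
  proof -
    have BD0: "(B * gl_inv k D) $$ (0, j) = 0" if "j < k" for j
    proof -
      have "B $$ (0, l) = 0" if "l < k" for l using row0[of "l + 2"] that by (simp add: B_def)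
      then show ?thesis using bc D'c that by (simp add: scalar_prod_def)
    qed
    have G00: "A $$ (0, 0) = 1" "A $$ (0, Suc 0) = 0" "A $$ (Suc 0, Suc 0) = 1"
      using row0[of 0] row0[of 1] col1[of 1] by (simp_all add: A_def)
    have Z1: "Z $$ (i, Suc 0) = 0" if "i < k" for i
      using col1[of "i + 2"] that by (simp add: Z_def)
    have "?e \<bullet> ?f = 0" by simp
    then have "transv ?N y ?e * transv ?N ?f z = transv ?N y ?e + outer ?f z"
      using yz by (simp add: transv_mult_transv) (auto intro!: eq_matI)
    also have "\<dots> = G"
    proof (rule eq_matI)
      fix i j assume "i < dim_row G" "j < dim_col G"
      then have ij: "i < ?N" "j < ?N" using Gc(2) by auto
      have "(transv ?N y ?e + outer ?f z) $$ (i, j) =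
          (if i = j then 1 else 0) + y $ i * (if j = 0 then 1 else 0) + (if i = 1 then 1 else 0) * z $ j"
        using ij yz by (simp add: transv_def)
      also have "\<dots> = G $$ (i, j)"
      proof -
        consider "i = 0" | "i = 1" | "i \<ge> 2" by linarith
        then show ?thesis
        proof cases
          case 1
          then show ?thesis using ij bc D'c BD0[of "j - 2"] G00
            by (cases "j < 2") (auto simp: y_def z_def Gb less_2_cases_iff)
        next
          case 2
          then show ?thesis using ij bc D'c G00
            by (cases "j < 2") (auto simp: y_def z_def Gb less_2_cases_iff)
        next
          case 3
          then show ?thesis using ij bc D'c Z1[of "i - 2"]
            by (cases "j < 2") (auto simp: y_def z_def Gb less_2_cases_iff)
        qed
      qed
      finally show "(transv ?N y ?e + outer ?f z) $$ (i, j) = G $$ (i, j)" .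
    qed (use Gc(2) yz in \<open>auto simp: transv_def\<close>)
    finally show ?thesis by simp
  qed
  moreover have "transv ?N y ?e \<in> E_rel ?N I"
    unfolding transv_def
  proof (rule unipotent_E_rel[where S = "{1..}"])
    fix i j assume "i < ?N" "j < ?N" "outer y ?e $$ (i, j) \<noteq> 0"
    then show "i \<in> {1..} \<and> j \<notin> {1..} \<and> outer y ?e $$ (i, j) \<in> I"
      using GL_rel_index[OF GR, of i 0] by (auto simp: y_def split: if_splits)
  qed (use yz in simp)
  moreover have "transv ?N ?f z \<in> E_rel ?N I"
    unfolding transv_def
  proof (rule unipotent_E_rel[where S = "{1}"])
    fix i j assume "i < ?N" "j < ?N" "outer ?f z $$ (i, j) \<noteq> 0"
    then show "i \<in> {1} \<and> j \<notin> {1} \<and> outer ?f z $$ (i, j) \<in> I"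
      using GL_rel_index[OF GR, of 1 j] by (auto simp: z_def split: if_splits)
  qed (use yz in simp)
  ultimately have "G \<in> E_rel ?N I" by (simp add: E_rel_mult)
  then show ?thesis using DS CG by blast
qed

lemma symplectic_reduction:
  assumes \<gamma>: "\<gamma> \<in> carrier (GL m)"
    and orbit: "\<And>i. i \<ge> 1 \<Longrightarrow>
      Um (2 * i + m) I \<subseteq> e1_orbit (2 * i + m) (E_rel (2 * i + m) I \<inter> Sp_rel (chi i \<perp> \<gamma>) I)"
    and B: "B \<in> Sp_rel (chi i \<perp> \<gamma>) I"
  shows "\<exists>D \<in> Sp_rel \<gamma> I. \<exists>\<epsilon> \<in> E_rel (2 * i + m) I. B = \<epsilon> * (1\<^sub>m (2 * i) \<perp> D)"
  using B
proof (induct i arbitrary: B)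
  case 0
  then have B: "B \<in> Sp_rel \<gamma> I" by (simp add: chi_0_sum del: chi.simps(1))
  then have "B \<in> carrier_mat m m"
    using Sp_relD(1)[OF B GL_carrier_mat[OF \<gamma>]] GL_relD(2) by blast
  then show ?case using B E_rel_one[of m I]
    by (intro bexI[of _ B] bexI[of _ "1\<^sub>m m"]) (auto simp: stab_zero)
next
  case (Suc i)
  let ?M = "2 * i + m" let ?N = "2 + ?M" let ?e = "unit_vec ?N 0 :: 'a vec"
  let ?\<tau> = "chi i \<perp> \<gamma>"
  have N: "2 * Suc i + m = ?N" by simp
  have \<Phi>: "chi (Suc i) \<perp> \<gamma> = chi1 \<perp> ?\<tau>"
    by (simp only: chi_Suc_left block_sum_assoc)
  have \<tau>: "?\<tau> \<in> carrier (GL ?M)" by (rule block_sum_GL(1)[OF chi_GL \<gamma>])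
  have \<Phi>c: "chi1 \<perp> ?\<tau> \<in> carrier_mat ?N ?N"
    by (intro block_sum_carrier chi1_carrier GL_carrier_mat[OF \<tau>])
  note BS = Sp_relD[OF Suc.prems[unfolded \<Phi>] \<Phi>c]
  note Bc = GL_relD[OF BS(1)]
  \<comment> \<open>The orbit hypothesis is applied to the first row of the inverse, so that the
    correction \<eta> multiplies \<open>B\<close> from the left and its inverse joins the other
    elementary factors there.\<close>
  have "row_mult ?e (gl_inv ?N B) \<in> Um ?N I" by (intro row_in_Um GL_rel_inv BS(1)) simp
  then have "row_mult ?e (gl_inv ?N B) \<in> e1_orbit ?N (E_rel ?N I \<inter> Sp_rel (chi1 \<perp> ?\<tau>) I)"
    using orbit[of "Suc i", unfolded N \<Phi>] by auto
  then obtain \<eta> where \<eta>: "\<eta> \<in> E_rel ?N I" "\<eta> \<in> Sp_rel (chi1 \<perp> ?\<tau>) I"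
    and e\<eta>: "row_mult ?e (gl_inv ?N B) = row_mult ?e \<eta>" by (auto simp: e1_orbit_def)
  note \<eta>S = Sp_relD[OF \<eta>(2) \<Phi>c]
  note \<eta>c = GL_relD[OF \<eta>S(1)]
  define C where "C = \<eta> * B"
  have CS: "C \<in> Sp_rel (chi1 \<perp> ?\<tau>) I"
    unfolding C_def
    by (rule Sp_rel_I[OF GL_rel_mult[OF \<eta>S(1) BS(1)] \<Phi>c symplectic_mult[OF \<eta>c(2) Bc(2) \<Phi>c \<eta>S(2) BS(2)]])
  have "row_mult ?e C = row_mult (row_mult ?e (gl_inv ?N B)) B"
    unfolding C_def e\<eta> using \<eta>c Bc by (simp add: row_mult_mult[of _ ?N])
  also have "\<dots> = ?e"
    by (simp only: row_mult_mult[OF unit_vec_carrier GL_inv_carrier_mat[OF Bc(1)] Bc(2)]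
        GL_l_inv[OF Bc(1)] row_mult_one[OF unit_vec_carrier])
  finally have "row_mult ?e C = ?e" .
  from symplectic_split_plane[OF \<tau> CS this] obtain D' G
    where D': "D' \<in> Sp_rel ?\<tau> I" and G: "G \<in> E_rel ?N I" "C = G * (1\<^sub>m 2 \<perp> D')" by blast
  from Suc.hyps[OF D'] obtain D \<epsilon>
    where D: "D \<in> Sp_rel \<gamma> I" and \<epsilon>: "\<epsilon> \<in> E_rel ?M I" "D' = \<epsilon> * (1\<^sub>m (2 * i) \<perp> D)" by blast
  note Dc = GL_relD(2)[OF Sp_relD(1)[OF D GL_carrier_mat[OF \<gamma>]]]
  note \<epsilon>c = E_rel_carrier_mat[OF \<epsilon>(1)] and Gc = E_rel_carrier_mat[OF G(1)]
  note \<eta>i = GL_inv_carrier_mat[OF \<eta>c(1)]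
  have s: "1\<^sub>m 2 \<perp> \<epsilon> \<in> E_rel ?N I" by (rule stab_E_rel[OF \<epsilon>(1)])
  note sc = E_rel_carrier_mat[OF s]
  let ?D = "1\<^sub>m (2 + 2 * i) \<perp> D"
  have sD: "?D \<in> carrier_mat ?N ?N"
    using block_sum_carrier[OF one_carrier_mat Dc, of "2 + 2 * i"] by (simp add: add.assoc)
  have "1\<^sub>m 2 \<perp> D' = (1\<^sub>m 2 \<perp> \<epsilon>) * ?D"
    unfolding \<epsilon>(2) using Dc \<epsilon>c stab_mult[of \<epsilon> ?M "1\<^sub>m (2 * i) \<perp> D" 2] by (simp add: stab_stab)
  then have C: "C = G * (1\<^sub>m 2 \<perp> \<epsilon>) * ?D" using G(2) Gc sc sD by (simp add: square_assoc[where n = ?N])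
  have "B = gl_inv ?N \<eta> * C"
    unfolding C_def using \<eta>c \<eta>i Bc GL_l_inv[OF \<eta>c(1)] by (simp add: assoc_mult_mat[of _ ?N ?N _ ?N _ ?N, symmetric])
  then have "B = (gl_inv ?N \<eta> * (G * (1\<^sub>m 2 \<perp> \<epsilon>))) * ?D"
    unfolding C using \<eta>i Gc sc sD by (simp add: square_simps[where n = ?N])
  moreover have "gl_inv ?N \<eta> * (G * (1\<^sub>m 2 \<perp> \<epsilon>)) \<in> E_rel ?N I"
    by (intro E_rel_mult E_rel_inv \<eta> G s)
  ultimately show ?case using D by (metis N mult_Suc_right)
qed

end

section \<open>The stable groups\<close>

lemma SL_group_simps [simp]:
  "carrier (SL_group n I) = SL_rel n I" "mult (SL_group n I) = (*)" "one (SL_group n I) = 1\<^sub>m n"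
  by (simp_all add: SL_group_def)

lemma mem_SL_lim_in:
  "(m, y) \<in> SL_lim_in I n x \<longleftrightarrow> x \<in> SL_rel n I \<and> y \<in> SL_rel m I \<and>
    (\<exists>p q. p + n = q + m \<and> 1\<^sub>m p \<perp> x = 1\<^sub>m q \<perp> y)"
  by (auto simp: SL_lim_in_def dl_in_def dl_rel_def stab_funpow add.commute)

lemma mult_SL_lim:
  "X \<otimes>\<^bsub>SL_lim I\<^esub> Y = (\<Union>(m, x)\<in>X. \<Union>(n, y)\<in>Y. SL_lim_in I (m + n) ((1\<^sub>m n \<perp> x) * (1\<^sub>m m \<perp> y)))"
  by (simp add: SL_lim_def direct_limit_def SL_lim_in_def stab_funpow)

lemma stab_prod:
  fixes x y :: "'a::comm_ring_1 mat"
  assumes "x \<in> carrier_mat m m" "y \<in> carrier_mat n n"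
  shows "1\<^sub>m p \<perp> ((1\<^sub>m n \<perp> x) * (1\<^sub>m m \<perp> y)) = (1\<^sub>m (p + n) \<perp> x) * (1\<^sub>m (p + m) \<perp> y)"
proof -
  have "1\<^sub>m n \<perp> x \<in> carrier_mat (m + n) (m + n)" "1\<^sub>m m \<perp> y \<in> carrier_mat (m + n) (m + n)"
    using assms block_sum_carrier[OF one_carrier_mat assms(1), of n] by (simp_all add: add.commute)
  then show ?thesis by (simp add: stab_mult[of _ "m + n"] stab_stab)
qed

context ring_ideal
begin

lemma SL_rel_carrier_mat: "A \<in> SL_rel n I \<Longrightarrow> A \<in> carrier_mat n n"
  by (simp add: SL_rel_def GL_relD)

lemma SL_rel_mult: "A \<in> SL_rel n I \<Longrightarrow> B \<in> SL_rel n I \<Longrightarrow> A * B \<in> SL_rel n I"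
  by (auto simp: SL_rel_def GL_rel_mult GL_relD det_mult[of _ n])

lemma stab_SL_rel: "A \<in> SL_rel n I \<Longrightarrow> 1\<^sub>m p \<perp> A \<in> SL_rel (p + n) I"
  by (auto simp: SL_rel_def block_sum_GL_rel GL_rel_one det_stab[of _ n] GL_relD)

lemma SL_lim_in_refl: "x \<in> SL_rel n I \<Longrightarrow> (n, x) \<in> SL_lim_in I n x"
  by (auto simp: mem_SL_lim_in)

lemma SL_lim_in_trans:
  assumes "(m, y) \<in> SL_lim_in I n x" "(l, z) \<in> SL_lim_in I m y"
  shows "(l, z) \<in> SL_lim_in I n x"
proof -
  from assms obtain p q p' q' where e: "p + n = q + m" "1\<^sub>m p \<perp> x = 1\<^sub>m q \<perp> y"
    "p' + m = q' + l" "1\<^sub>m p' \<perp> y = 1\<^sub>m q' \<perp> z"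
    by (auto simp: mem_SL_lim_in)
  have "1\<^sub>m (p' + p) \<perp> x = 1\<^sub>m p' \<perp> (1\<^sub>m q \<perp> y)" using e by (simp add: stab_stab[symmetric])
  also have "\<dots> = 1\<^sub>m q \<perp> (1\<^sub>m p' \<perp> y)" by (simp add: stab_stab add.commute)
  also have "\<dots> = 1\<^sub>m (q + q') \<perp> z" using e by (simp add: stab_stab)
  finally have "1\<^sub>m (p' + p) \<perp> x = 1\<^sub>m (q + q') \<perp> z" .
  moreover have "(p' + p) + n = (q + q') + l" using e by simp
  ultimately show ?thesis using assms by (auto simp: mem_SL_lim_in)
qed

lemma SL_lim_in_sym: "(m, y) \<in> SL_lim_in I n x \<Longrightarrow> (n, x) \<in> SL_lim_in I m y"
  by (auto simp: mem_SL_lim_in) metis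

lemma SL_lim_in_eq:
  assumes "(m, y) \<in> SL_lim_in I n x"
  shows "SL_lim_in I m y = SL_lim_in I n x"
  using SL_lim_in_trans[OF assms] SL_lim_in_trans[OF SL_lim_in_sym[OF assms]] by auto

lemma prod_SL_rel:
  assumes "x \<in> SL_rel m I" "y \<in> SL_rel n I"
  shows "(1\<^sub>m n \<perp> x) * (1\<^sub>m m \<perp> y) \<in> SL_rel (m + n) I"
  using stab_SL_rel[OF assms(1), of n] stab_SL_rel[OF assms(2), of m]
  by (intro SL_rel_mult) (simp_all add: add.commute)

text \<open>Independence of representatives: the union defining the product is constant. Two
  products of representatives are compared at size \<open>p + r + (m + n)\<close>, where both pairs
  of paddings fit.\<close>

lemma mult_SL_lim_in:
  assumes x: "x \<in> SL_rel m I" and y: "y \<in> SL_rel n I"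
  shows "SL_lim_in I m x \<otimes>\<^bsub>SL_lim I\<^esub> SL_lim_in I n y = SL_lim_in I (m + n) ((1\<^sub>m n \<perp> x) * (1\<^sub>m m \<perp> y))"
proof -
  have "SL_lim_in I (m' + n') ((1\<^sub>m n' \<perp> x') * (1\<^sub>m m' \<perp> y')) =
      SL_lim_in I (m + n) ((1\<^sub>m n \<perp> x) * (1\<^sub>m m \<perp> y))"
    if x': "(m', x') \<in> SL_lim_in I m x" and y': "(n', y') \<in> SL_lim_in I n y" for m' x' n' y'
  proof (rule SL_lim_in_eq)
    obtain p q where p: "p + m = q + m'" "1\<^sub>m p \<perp> x = 1\<^sub>m q \<perp> x'" "x' \<in> SL_rel m' I"
      using x' by (auto simp: mem_SL_lim_in)
    obtain r t where r: "r + n = t + n'" "1\<^sub>m r \<perp> y = 1\<^sub>m t \<perp> y'" "y' \<in> SL_rel n' I"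
      using y' by (auto simp: mem_SL_lim_in)
    note c = x[THEN SL_rel_carrier_mat] y[THEN SL_rel_carrier_mat] p(3)[THEN SL_rel_carrier_mat]
      r(3)[THEN SL_rel_carrier_mat]
    have 1: "1\<^sub>m (p + r + n) \<perp> x = 1\<^sub>m (q + t + n') \<perp> x'"
    proof -
      have "p + r + n = t + n' + p" using r(1) by simp
      then have "1\<^sub>m (p + r + n) \<perp> x = 1\<^sub>m (t + n') \<perp> (1\<^sub>m p \<perp> x)" by (simp only: stab_stab)
      then show ?thesis using p(2) by (simp add: stab_stab ac_simps)
    qed
    have 2: "1\<^sub>m (p + r + m) \<perp> y = 1\<^sub>m (q + t + m') \<perp> y'"
    proof -
      have "p + r + m = q + m' + r" using p(1) by simp
      then have "1\<^sub>m (p + r + m) \<perp> y = 1\<^sub>m (q + m') \<perp> (1\<^sub>m r \<perp> y)" by (simp only: stab_stab)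
      then show ?thesis using r(2) by (simp add: stab_stab ac_simps)
    qed
    have "1\<^sub>m (p + r) \<perp> ((1\<^sub>m n \<perp> x) * (1\<^sub>m m \<perp> y)) = 1\<^sub>m (q + t) \<perp> ((1\<^sub>m n' \<perp> x') * (1\<^sub>m m' \<perp> y'))"
      using 1 2 c by (simp add: stab_prod)
    moreover have "p + r + (m + n) = q + t + (m' + n')" using p(1) r(1) by simp
    ultimately show "(m' + n', (1\<^sub>m n' \<perp> x') * (1\<^sub>m m' \<perp> y')) \<in> SL_lim_in I (m + n) ((1\<^sub>m n \<perp> x) * (1\<^sub>m m \<perp> y))"
      using prod_SL_rel x y p(3) r(3) by (auto simp: mem_SL_lim_in)
  qed
  note const = this
  show ?thesis
    unfolding mult_SL_lim
  proof (intro equalityI subsetI)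
    fix z
    assume "z \<in> (\<Union>(m', x')\<in>SL_lim_in I m x. \<Union>(n', y')\<in>SL_lim_in I n y.
      SL_lim_in I (m' + n') ((1\<^sub>m n' \<perp> x') * (1\<^sub>m m' \<perp> y')))"
    then obtain m' x' n' y' where "(m', x') \<in> SL_lim_in I m x" "(n', y') \<in> SL_lim_in I n y"
      "z \<in> SL_lim_in I (m' + n') ((1\<^sub>m n' \<perp> x') * (1\<^sub>m m' \<perp> y'))" by auto
    then show "z \<in> SL_lim_in I (m + n) ((1\<^sub>m n \<perp> x) * (1\<^sub>m m \<perp> y))" by (simp only: const)
  next
    fix z
    assume "z \<in> SL_lim_in I (m + n) ((1\<^sub>m n \<perp> x) * (1\<^sub>m m \<perp> y))"
    then show "z \<in> (\<Union>(m', x')\<in>SL_lim_in I m x. \<Union>(n', y')\<in>SL_lim_in I n y.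
      SL_lim_in I (m' + n') ((1\<^sub>m n' \<perp> x') * (1\<^sub>m m' \<perp> y')))"
      by (intro UN_I[OF SL_lim_in_refl[OF x]])
        (simp, rule bexI[OF _ SL_lim_in_refl[OF y]], simp)
  qed
qed

section \<open>Cosets and representatives in the stable quotients\<close>

lemma to_SK1_coset:
  "to_SK1 I N (E_rel N I #>\<^bsub>SL_group N I\<^esub> \<alpha>) =
    {SL_lim_in I k \<epsilon>0 \<otimes>\<^bsub>SL_lim I\<^esub> SL_lim_in I N (\<epsilon>1 * \<alpha>) | k \<epsilon>0 \<epsilon>1. \<epsilon>0 \<in> E_rel k I \<and> \<epsilon>1 \<in> E_rel N I}"
  by (auto simp: to_SK1_def quot_map_def set_mult_def r_coset_def E_lim_def; blast)

text \<open>The image of a coset is a set of products of limit classes, so equality of images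
  reduces to two inclusions, each from an equation of this shape.\<close>

lemma to_SK1_coset_subset:
  assumes \<alpha>: "\<alpha> \<in> SL_rel N I" and D: "D \<in> SL_rel N I" and \<epsilon>: "\<epsilon> \<in> E_rel (p + N) I"
    and eq: "1\<^sub>m p \<perp> \<alpha> = \<epsilon> * (1\<^sub>m p \<perp> D)"
  shows "to_SK1 I N (E_rel N I #>\<^bsub>SL_group N I\<^esub> \<alpha>) \<subseteq> to_SK1 I N (E_rel N I #>\<^bsub>SL_group N I\<^esub> D)"
proof
  fix X assume "X \<in> to_SK1 I N (E_rel N I #>\<^bsub>SL_group N I\<^esub> \<alpha>)"
  then obtain k \<epsilon>0 \<epsilon>1 where e: "\<epsilon>0 \<in> E_rel k I" "\<epsilon>1 \<in> E_rel N I"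
    and X: "X = SL_lim_in I k \<epsilon>0 \<otimes>\<^bsub>SL_lim I\<^esub> SL_lim_in I N (\<epsilon>1 * \<alpha>)"
    unfolding to_SK1_coset by blast
  note eS = e[THEN E_rel_SL_rel]
  note c = e[THEN E_rel_carrier_mat] E_rel_carrier_mat[OF \<epsilon>] \<alpha>[THEN SL_rel_carrier_mat]
    D[THEN SL_rel_carrier_mat]
  have \<epsilon>1\<alpha>: "\<epsilon>1 * \<alpha> \<in> SL_rel N I" by (intro SL_rel_mult eS \<alpha>)
  \<comment> \<open>At this size the three elementary matrices can be multiplied into one.\<close>
  define M where "M = k + (p + N)"
  define a where "a = 1\<^sub>m (p + N) \<perp> \<epsilon>0"
  define b where "b = 1\<^sub>m (k + p) \<perp> \<epsilon>1"
  define d where "d = 1\<^sub>m k \<perp> \<epsilon>"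
  have abd: "a \<in> E_rel M I" "b \<in> E_rel M I" "d \<in> E_rel M I"
    using stab_E_rel[OF e(1), of "p + N"] stab_E_rel[OF e(2), of "k + p"] stab_E_rel[OF \<epsilon>, of k]
    by (simp_all add: a_def b_def d_def M_def ac_simps)
  note abdc = abd[THEN E_rel_carrier_mat]
  define \<epsilon>' where "\<epsilon>' = a * (b * d)"
  have \<epsilon>': "\<epsilon>' \<in> E_rel M I" unfolding \<epsilon>'_def by (intro E_rel_mult abd)
  have sD: "1\<^sub>m (k + p) \<perp> D \<in> carrier_mat M M"
    using block_sum_carrier[OF one_carrier_mat c(5), of "k + p"] by (simp add: M_def ac_simps)
  have "1\<^sub>m (k + p) \<perp> (\<epsilon>1 * \<alpha>) = b * (1\<^sub>m k \<perp> (1\<^sub>m p \<perp> \<alpha>))"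
    using c by (simp add: stab_mult[of _ N] b_def stab_stab)
  also have "1\<^sub>m k \<perp> (1\<^sub>m p \<perp> \<alpha>) = d * (1\<^sub>m (k + p) \<perp> D)"
    unfolding eq using c stab_mult[of \<epsilon> "p + N" "1\<^sub>m p \<perp> D" k] by (simp add: d_def stab_stab)
  finally have "1\<^sub>m p \<perp> ((1\<^sub>m N \<perp> \<epsilon>0) * (1\<^sub>m k \<perp> (\<epsilon>1 * \<alpha>))) = a * (b * (d * (1\<^sub>m (k + p) \<perp> D)))"
    using c by (simp add: stab_prod square_mult_closed a_def add.commute)
  also have "\<dots> = \<epsilon>' * (1\<^sub>m (k + p) \<perp> D)"
    using abdc sD by (simp add: \<epsilon>'_def square_simps[where n = M])
  finally have 1: "1\<^sub>m p \<perp> ((1\<^sub>m N \<perp> \<epsilon>0) * (1\<^sub>m k \<perp> (\<epsilon>1 * \<alpha>))) = \<epsilon>' * (1\<^sub>m (k + p) \<perp> D)" .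
  \<comment> \<open>\<open>N\<close> more identity rows are inserted because the product of classes
    at stages \<open>M\<close> and \<open>N\<close> is formed at stage \<open>M + N\<close>.\<close>
  have "1\<^sub>m (N + p) \<perp> ((1\<^sub>m N \<perp> \<epsilon>0) * (1\<^sub>m k \<perp> (\<epsilon>1 * \<alpha>))) = 1\<^sub>m N \<perp> (\<epsilon>' * (1\<^sub>m (k + p) \<perp> D))"
    by (simp add: stab_stab[symmetric] 1)
  also have "\<dots> = (1\<^sub>m N \<perp> \<epsilon>') * (1\<^sub>m M \<perp> D)"
    using E_rel_carrier_mat[OF \<epsilon>'] sD by (simp add: stab_mult[of _ M] stab_stab M_def ac_simps)
  finally have 2: "1\<^sub>m (N + p) \<perp> ((1\<^sub>m N \<perp> \<epsilon>0) * (1\<^sub>m k \<perp> (\<epsilon>1 * \<alpha>))) = 1\<^sub>m 0 \<perp> ((1\<^sub>m N \<perp> \<epsilon>') * (1\<^sub>m M \<perp> D))"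
    by (simp add: stab_zero)
  have "(N + p) + (k + N) = 0 + (M + N)" by (simp add: M_def)
  then have "(M + N, (1\<^sub>m N \<perp> \<epsilon>') * (1\<^sub>m M \<perp> D)) \<in> SL_lim_in I (k + N) ((1\<^sub>m N \<perp> \<epsilon>0) * (1\<^sub>m k \<perp> (\<epsilon>1 * \<alpha>)))"
    unfolding mem_SL_lim_in using 2 prod_SL_rel[OF eS(1) \<epsilon>1\<alpha>] prod_SL_rel[OF E_rel_SL_rel[OF \<epsilon>'] D] by blast
  then have "X = SL_lim_in I M \<epsilon>' \<otimes>\<^bsub>SL_lim I\<^esub> SL_lim_in I N (1\<^sub>m N * D)"
    using X SL_lim_in_eq c by (simp add: mult_SL_lim_in eS \<epsilon>1\<alpha> E_rel_SL_rel[OF \<epsilon>'] D)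
  then show "X \<in> to_SK1 I N (E_rel N I #>\<^bsub>SL_group N I\<^esub> D)"
    unfolding to_SK1_coset using \<epsilon>' E_rel_one by blast
qed

text \<open>The stable equation can be solved for \<open>D\<close> as well, which gives the reverse
  inclusion. Injectivity then identifies the unstable cosets, and \<alpha> lies in its own.\<close>

lemma SK1_injective_descent:
  assumes inj: "inj_on (to_SK1 I N) (carrier (SL_group N I Mod E_rel N I))"
    and \<alpha>: "\<alpha> \<in> SL_rel N I" and D: "D \<in> SL_rel N I" and \<epsilon>: "\<epsilon> \<in> E_rel (p + N) I"
    and eq: "1\<^sub>m p \<perp> \<alpha> = \<epsilon> * (1\<^sub>m p \<perp> D)"
  shows "\<exists>\<epsilon>' \<in> E_rel N I. \<alpha> = \<epsilon>' * D"
proof -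
  let ?C = "\<lambda>x. E_rel N I #>\<^bsub>SL_group N I\<^esub> x"
  note c = \<alpha>[THEN SL_rel_carrier_mat] D[THEN SL_rel_carrier_mat]
  have sD: "1\<^sub>m p \<perp> D \<in> carrier_mat (p + N) (p + N)" using c by simp
  have "1\<^sub>m p \<perp> D = gl_inv (p + N) \<epsilon> * (1\<^sub>m p \<perp> \<alpha>)"
  proof -
    note g = E_rel_GL[OF \<epsilon>]
    have "gl_inv (p + N) \<epsilon> * (\<epsilon> * (1\<^sub>m p \<perp> D)) = (gl_inv (p + N) \<epsilon> * \<epsilon>) * (1\<^sub>m p \<perp> D)"
      by (rule square_assoc[symmetric, OF GL_inv_carrier_mat[OF g] GL_carrier_mat[OF g] sD])
    then show ?thesis by (simp add: eq GL_l_inv[OF g] left_mult_one_mat[OF sD])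
  qed
  then have "to_SK1 I N (?C \<alpha>) = to_SK1 I N (?C D)"
    using to_SK1_coset_subset[OF \<alpha> D \<epsilon> eq] to_SK1_coset_subset[OF D \<alpha> E_rel_inv[OF \<epsilon>]] by blast
  moreover have "?C x \<in> carrier (SL_group N I Mod E_rel N I)" if "x \<in> SL_rel N I" for x
    using that by (auto simp: FactGroup_def RCOSETS_def)
  ultimately have "?C \<alpha> = ?C D" using inj \<alpha> D by (meson inj_onD)
  moreover have "\<alpha> \<in> ?C \<alpha>" using E_rel_one[of N I] c by (force simp: r_coset_def)
  ultimately show ?thesis by (auto simp: r_coset_def)
qed

lemma K1Sp_image_representative:
  assumes \<alpha>: "\<alpha> \<in> SL_rel N I"
    and im: "SK1_class I N \<alpha> \<in> K1Sp_to_SK1 I ` carrier (K1Sp I)"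
  shows "\<exists>m \<beta> k \<epsilon> p q r. \<beta> \<in> Sp_rel (chi m) I \<and> \<epsilon> \<in> E_rel k I \<and> p + N = q + k \<and> p + N = r + 2 * m \<and>
    1\<^sub>m p \<perp> \<alpha> = (1\<^sub>m q \<perp> \<epsilon>) * (1\<^sub>m r \<perp> \<beta>)"
proof -
  \<comment> \<open>The empty matrix represents the unit of \<open>E_lim\<close>, so the class of
    \<alpha> is a member of the coset \<open>SK1_class I N \<alpha>\<close>.\<close>
  have one: "1\<^sub>m 0 \<in> E_rel 0 I" "1\<^sub>m 0 \<in> SL_rel 0 I" by (rule E_rel_one, rule E_rel_SL_rel, rule E_rel_one)
  have "SL_lim_in I 0 (1\<^sub>m 0) \<otimes>\<^bsub>SL_lim I\<^esub> SL_lim_in I N \<alpha> = SL_lim_in I N \<alpha>"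
    using mult_SL_lim_in[OF one(2) \<alpha>] SL_rel_carrier_mat[OF \<alpha>] by (simp add: block_sum_one stab_zero)
  moreover have "SL_lim_in I 0 (1\<^sub>m 0) \<in> E_lim I" unfolding E_lim_def using one(1) by blast
  ultimately have "SL_lim_in I N \<alpha> \<in> SK1_class I N \<alpha>" by (force simp: SK1_class_def r_coset_def)
  then obtain X where X: "X \<in> carrier (K1Sp I)" "SL_lim_in I N \<alpha> \<in> K1Sp_to_SK1 I X" using im by auto
  then obtain k \<epsilon> z where \<epsilon>: "\<epsilon> \<in> E_rel k I" and z: "z \<in> X"
    and eq: "SL_lim_in I N \<alpha> = SL_lim_in I k \<epsilon> \<otimes>\<^bsub>SL_lim I\<^esub> Sp_to_SL I z"
    by (auto simp: K1Sp_to_SK1_def quot_map_def set_mult_def E_lim_def)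
  have "(N, \<alpha>) \<in> SL_lim_in I k \<epsilon> \<otimes>\<^bsub>SL_lim I\<^esub> Sp_to_SL I z"
    using SL_lim_in_refl[OF \<alpha>] eq by simp
  then obtain k' \<epsilon>' l y m \<beta> where \<epsilon>': "(k', \<epsilon>') \<in> SL_lim_in I k \<epsilon>" and \<beta>: "(m, \<beta>) \<in> z"
    and y: "(l, y) \<in> SL_lim_in I (2 * m) \<beta>"
    and mem: "(N, \<alpha>) \<in> SL_lim_in I (k' + l) ((1\<^sub>m l \<perp> \<epsilon>') * (1\<^sub>m k' \<perp> y))"
    by (auto simp: mult_SL_lim Sp_to_SL_def)
  \<comment> \<open>\<open>z\<close> is a product in the symplectic limit, hence a union of classes,
    and every pair in such a class has its matrix in the symplectic group of its stage.\<close>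
  obtain b where "z \<in> ESp_lim I #>\<^bsub>Sp_lim I\<^esub> b"
    using X(1) z by (auto simp: K1Sp_def FactGroup_def RCOSETS_def)
  then obtain h where "z = h \<otimes>\<^bsub>Sp_lim I\<^esub> b" by (auto simp: r_coset_def)
  then have "\<beta> \<in> carrier (Sp_group m I)"
    using \<beta> by (auto simp: Sp_lim_def direct_limit_def dl_in_def dl_rel_def)
  then have \<beta>S: "\<beta> \<in> Sp_rel (chi m) I" by (simp add: Sp_group_def)
  obtain a b where a: "a + k = b + k'" "1\<^sub>m a \<perp> \<epsilon> = 1\<^sub>m b \<perp> \<epsilon>'" "\<epsilon>' \<in> SL_rel k' I"
    using \<epsilon>' by (auto simp: mem_SL_lim_in)
  obtain c d where c: "c + 2 * m = d + l" "1\<^sub>m c \<perp> \<beta> = 1\<^sub>m d \<perp> y" "y \<in> SL_rel l I"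
    using y by (auto simp: mem_SL_lim_in)
  obtain f g where f: "f + (k' + l) = g + N" "1\<^sub>m f \<perp> ((1\<^sub>m l \<perp> \<epsilon>') * (1\<^sub>m k' \<perp> y)) = 1\<^sub>m g \<perp> \<alpha>"
    using mem by (auto simp: mem_SL_lim_in)
  \<comment> \<open>The paddings by which the representatives agree are combined into a single
    equation at one common size.\<close>
  have "1\<^sub>m (b + d + g) \<perp> \<alpha> = 1\<^sub>m (b + d + f) \<perp> ((1\<^sub>m l \<perp> \<epsilon>') * (1\<^sub>m k' \<perp> y))"
    using f(2) by (simp add: stab_stab[symmetric])
  also have "\<dots> = (1\<^sub>m (b + d + f + l) \<perp> \<epsilon>') * (1\<^sub>m (b + d + f + k') \<perp> y)"
    using SL_rel_carrier_mat[OF a(3)] SL_rel_carrier_mat[OF c(3)] by (rule stab_prod)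
  also have "1\<^sub>m (b + d + f + l) \<perp> \<epsilon>' = 1\<^sub>m (d + f + l) \<perp> (1\<^sub>m b \<perp> \<epsilon>')" by (simp add: stab_stab ac_simps)
  also have "\<dots> = 1\<^sub>m (d + f + l + a) \<perp> \<epsilon>" by (simp add: a(2)[symmetric] stab_stab)
  also have "1\<^sub>m (b + d + f + k') \<perp> y = 1\<^sub>m (b + f + k') \<perp> (1\<^sub>m d \<perp> y)" by (simp add: stab_stab ac_simps)
  also have "\<dots> = 1\<^sub>m (b + f + k' + c) \<perp> \<beta>" by (simp add: c(2)[symmetric] stab_stab)
  finally have "1\<^sub>m (b + d + g) \<perp> \<alpha> = (1\<^sub>m (d + f + l + a) \<perp> \<epsilon>) * (1\<^sub>m (b + f + k' + c) \<perp> \<beta>)" .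
  moreover have "b + d + g + N = d + f + l + a + k" "b + d + g + N = b + f + k' + c + 2 * m"
    using a(1) c(1) f(1) by linarith+
  ultimately show ?thesis using \<beta>S \<epsilon> by blast
qed

end

theorem proposition7p6:
  fixes I :: "'a::comm_ring_1 set" and n :: nat and \<gamma> :: "'a mat" and v :: "'a vec"
  assumes "ideal I (class_ring :: 'a ring)"
    and "n \<ge> 2"
    and "\<gamma> \<in> Alt n I"
    and "v \<in> Um (2 * n) I"
    and "inj_on (to_SK1 I (2 * n)) (carrier (SL_group (2 * n) I Mod E_rel (2 * n) I))"
    and "\<exists>\<alpha> \<in> SL_rel (2 * n) I. v = row_mult (unit_vec (2 * n) 0) \<alpha> \<and>
           SK1_class I (2 * n) \<alpha> \<in> K1Sp_to_SK1 I ` carrier (K1Sp I)"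
    and "\<forall>i \<ge> 1. Um (2 * n + 2 * i) I =
           e1_orbit (2 * n + 2 * i) (E_rel (2 * n + 2 * i) I \<inter> Sp_rel (chi i \<perp> \<gamma>) I)"
  shows "v \<in> e1_orbit (2 * n) (Sp_rel \<gamma> I)"
proof -
  let ?N = "2 * n" let ?e = "unit_vec ?N 0 :: 'a vec"
  interpret ring_ideal I by (rule ring_ideal.intro[OF assms(1)])
  have \<gamma>: "\<gamma> \<in> carrier (GL ?N)" "alternating_mat \<gamma>" using assms(3) by (simp_all add: Alt_def)
  interpret relative_form I ?N \<gamma>
    by standard (use \<gamma> assms(2) in auto)
  note \<gamma>c = GL_carrier_mat[OF \<gamma>(1)]
  obtain \<alpha> where \<alpha>: "\<alpha> \<in> SL_rel ?N I" "v = row_mult ?e \<alpha>"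
    "SK1_class I ?N \<alpha> \<in> K1Sp_to_SK1 I ` carrier (K1Sp I)" using assms(6) by blast
  note \<alpha>c = SL_rel_carrier_mat[OF \<alpha>(1)]
  obtain m \<beta> k \<epsilon> p q r where \<beta>: "\<beta> \<in> Sp_rel (chi m) I" and \<epsilon>: "\<epsilon> \<in> E_rel k I"
    and sizes: "p + ?N = q + k" "p + ?N = r + 2 * m"
    and eq: "1\<^sub>m p \<perp> \<alpha> = (1\<^sub>m q \<perp> \<epsilon>) * (1\<^sub>m r \<perp> \<beta>)"
    using K1Sp_image_representative[OF \<alpha>(1,3)] by blast
  note \<beta>c = GL_relD(2)[OF Sp_relD(1)[OF \<beta> chi_carrier]]
  \<comment> \<open>\<open>M\<close> only has to be large: it bounds \<open>m\<close> and
    \<open>n\<close>, and \<open>4 * M\<close> bounds the size of the stable equation. The total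
    size \<open>4 * M\<close> is twice \<open>2 * M\<close>, as Whitehead requires; \<open>t\<close>
    pads the equation to it, and \<open>i\<close> is the number of planes in
    \<open>chi M \<perp> chi (M - n)\<close>.\<close>
  define M where "M = p + ?N + m + n"
  define t where "t = 4 * M - (p + ?N)"
  define i where "i = M + (M - n)"
  have M: "m \<le> M" "n \<le> M" and i: "i \<ge> 1" and i4: "2 * i + ?N = 4 * M" and tp: "t + p = 2 * i"
    and tq: "t + q + k = 4 * M" and tr: "t + r = 2 * M + 2 * (M - m)"
    using assms(2) sizes by (auto simp: M_def t_def i_def)
  have M2: "2 * M + 2 * M = 4 * M" by simp
  define \<beta>' where "\<beta>' = 1\<^sub>m (2 * (M - m)) \<perp> \<beta>"
  have "\<beta>' \<in> Sp_rel (chi (M - m) \<perp> chi m) I"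
    unfolding \<beta>'_def
    by (rule block_sum_Sp_rel[OF one_Sp_rel[OF chi_carrier] \<beta> chi_carrier chi_carrier])
  then have \<beta>'S: "\<beta>' \<in> Sp_rel (chi M) I" using M by (simp add: chi_add[symmetric])
  note \<beta>'R = Sp_relD(1)[OF \<beta>'S chi_carrier]
  note \<beta>'c = GL_relD(1,2)[OF \<beta>'R]
  note \<beta>'i = GL_inv_carrier_mat[OF \<beta>'c(1)]
  \<comment> \<open>Whitehead is applied to the inverse of \<open>\<beta>'\<close>, so that
    \<open>W\<close> carries the copy of \<open>\<beta>'\<close> in the upper left corner to the
    lower right one.\<close>
  define W where "W = gl_inv (2 * M) \<beta>' \<perp> \<beta>'"
  have W: "W \<in> E_rel (4 * M) I"
    using whitehead[OF GL_rel_inv[OF \<beta>'R]] unfolding GL_inv_inv[OF \<beta>'c(1)] M2 W_def .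
  define B where "B = \<beta>' \<perp> 1\<^sub>m (2 * M)"
  have WB: "1\<^sub>m (2 * M) \<perp> \<beta>' = W * B"
    using \<beta>'c \<beta>'i by (simp add: W_def B_def block_sum_mult[of _ "2 * M" _ _ "2 * M"] GL_l_inv)
  \<comment> \<open>In the upper left corner \<open>\<beta>'\<close> faces \<open>chi M\<close>, and
    the identity faces the part containing \<gamma>.\<close>
  have "B \<in> Sp_rel (chi i \<perp> \<gamma>) I"
  proof -
    have "1\<^sub>m (2 * (M - n)) \<perp> 1\<^sub>m ?N \<in> Sp_rel (chi (M - n) \<perp> \<gamma>) I"
      by (rule block_sum_Sp_rel[OF one_Sp_rel[OF chi_carrier] one_Sp_rel[OF \<gamma>c] chi_carrier \<gamma>c])
    then have "1\<^sub>m (2 * M) \<in> Sp_rel (chi (M - n) \<perp> \<gamma>) I"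
      using M by (simp add: block_sum_one algebra_simps)
    then have "B \<in> Sp_rel (chi M \<perp> (chi (M - n) \<perp> \<gamma>)) I"
      unfolding B_def by (rule block_sum_Sp_rel[OF \<beta>'S _ chi_carrier block_sum_carrier[OF chi_carrier \<gamma>c]])
    then show ?thesis by (simp add: block_sum_assoc i_def chi_add)
  qed
  moreover have "Um (2 * j + ?N) I \<subseteq> e1_orbit (2 * j + ?N) (E_rel (2 * j + ?N) I \<inter> Sp_rel (chi j \<perp> \<gamma>) I)"
    if "j \<ge> 1" for j
    using assms(7) that by (simp add: add.commute)
  ultimately obtain D \<epsilon>2 where D: "D \<in> Sp_rel \<gamma> I" and \<epsilon>2: "\<epsilon>2 \<in> E_rel (2 * i + ?N) I"
    and BD: "B = \<epsilon>2 * (1\<^sub>m (2 * i) \<perp> D)"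
    using symplectic_reduction[OF \<gamma>(1), where i = i and B = B] by blast
  note DS = Sp_relD[OF D \<gamma>c]
  note Dc = GL_relD(2)[OF DS(1)]
  define \<epsilon>1 where "\<epsilon>1 = 1\<^sub>m (t + q) \<perp> \<epsilon>"
  have \<epsilon>1: "\<epsilon>1 \<in> E_rel (4 * M) I" using stab_E_rel[OF \<epsilon>, of "t + q"] by (simp add: \<epsilon>1_def tq)
  have \<epsilon>2': "\<epsilon>2 \<in> E_rel (4 * M) I" using \<epsilon>2 i4 by simp
  define \<eta> where "\<eta> = \<epsilon>1 * (W * \<epsilon>2)"
  have \<eta>: "\<eta> \<in> E_rel (2 * i + ?N) I" unfolding \<eta>_def i4 by (intro E_rel_mult \<epsilon>1 W \<epsilon>2')
  have sD: "1\<^sub>m (2 * i) \<perp> D \<in> carrier_mat (4 * M) (4 * M)"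
    using block_sum_carrier[OF one_carrier_mat Dc, of "2 * i"] by (simp only: i4)
  have "1\<^sub>m (2 * i) \<perp> \<alpha> = 1\<^sub>m t \<perp> (1\<^sub>m p \<perp> \<alpha>)" by (simp add: stab_stab tp)
  also have "\<dots> = \<epsilon>1 * (1\<^sub>m (t + r) \<perp> \<beta>)"
  proof -
    have "1\<^sub>m q \<perp> \<epsilon> \<in> carrier_mat (p + ?N) (p + ?N)" "1\<^sub>m r \<perp> \<beta> \<in> carrier_mat (p + ?N) (p + ?N)"
      using block_sum_carrier[OF one_carrier_mat E_rel_carrier_mat[OF \<epsilon>], of q]
        block_sum_carrier[OF one_carrier_mat \<beta>c, of r] sizes by simp_all
    then show ?thesis unfolding eq by (simp add: stab_mult stab_stab \<epsilon>1_def)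
  qed
  also have "1\<^sub>m (t + r) \<perp> \<beta> = 1\<^sub>m (2 * M) \<perp> \<beta>'" by (simp add: \<beta>'_def stab_stab tr)
  also have "\<epsilon>1 * \<dots> = \<eta> * (1\<^sub>m (2 * i) \<perp> D)"
    unfolding WB BD \<eta>_def using \<epsilon>1[THEN E_rel_carrier_mat] W[THEN E_rel_carrier_mat] \<epsilon>2'[THEN E_rel_carrier_mat] sD
    by (simp add: square_simps[where n = "4 * M"])
  finally have \<alpha>D: "1\<^sub>m (2 * i) \<perp> \<alpha> = \<eta> * (1\<^sub>m (2 * i) \<perp> D)" .
  \<comment> \<open>The determinant is read off from the stable equation, whose other factors have
    determinant 1.\<close>
  have "det D = 1"
  proof -
    have "det \<alpha> = det \<eta> * det D"
      using arg_cong[OF \<alpha>D, of det] E_rel_carrier_mat[OF \<eta>] sD det_stab[OF \<alpha>c] det_stab[OF Dc]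
      by (simp add: det_mult[of _ "4 * M"] i4)
    then show ?thesis using \<alpha>(1) E_rel_SL_rel[OF \<eta>] by (simp add: SL_rel_def)
  qed
  then have "D \<in> SL_rel ?N I" using DS(1) by (simp add: SL_rel_def)
  from SK1_injective_descent[OF assms(5) \<alpha>(1) this \<eta> \<alpha>D] obtain \<epsilon>' where \<epsilon>': "\<epsilon>' \<in> E_rel ?N I" "\<alpha> = \<epsilon>' * D"
    by blast
  \<comment> \<open>Only now are the elementary and the symplectic orbit exchanged; \<open>D\<close>
    then acts within the latter.\<close>
  have "row_mult ?e \<epsilon>' \<in> e1_orbit ?N (Sp_rel \<gamma> I)"
    using e1_E_rel_orbit \<epsilon>'(1) by (auto simp: e1_orbit_def)
  then have "row_mult (row_mult ?e \<epsilon>') D \<in> e1_orbit ?N (Sp_rel \<gamma> I)" using D by (rule orb_mult)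
  then show ?thesis
    using \<alpha>(2) \<epsilon>' E_rel_carrier_mat[OF \<epsilon>'(1)] Dc by (simp add: row_mult_mult[of _ ?N])
qed

end
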